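(* Let $(E,\mathcal L,\mathcal B)$ be a normal labelled space such that every cycle has an exit, let $K$ be a field, let $A$ be a $K$-algebra, and let $\phi:L_K(E,\mathcal L,\mathcal B)\to A$ be a $K$-algebra homomorphism. Then $\phi$ is injective if and only if $\phi(p_B)\neq0$ for every nonempty $B\in\mathcal B$.
   Context: Graphs and labels. A directed graph $E=(E^0,E^1,r,s)$ has a nonempty vertex set $E^0$, an edge set $E^1$, and range and source maps $r,s:E^1\to E^0$. A path of length $n\ge1$ is a sequence $\lambda=\lambda_1\cdots\lambda_n$ of edges with $r(\lambda_i)=s(\lambda_{i+1})$; its source is $s(\lambda_1)$ and its range is $r(\lambda_n)$; $E^n$ is the set of paths of length $n$. A labelled graph $(E,\mathcal L)$ is a directed graph with a surjective map $\mathcal L:E^1\to\mathcal A$ onto a nonempty set $\mathcal A$ (the alphabet), extended to paths by $\mathcal L(\lambda_1\cdots\lambda_n)=\mathcal L(\lambda_1)\cdots\mathcal L(\lambda_n)$. Put $\mathcal L^n=\mathcal L(E^n)$ for $n\geq 1$, $\mathcal L^{\ge1}=\bigcup_{n\ge1}\mathcal L^n$ and $\mathcal L^*=\mathcal L^{\ge1}\cup\{\omega\}$, with $\omega$ the empty word; $|\alpha|$ is the length of the word $\alpha$. For $\alpha=\alpha_1\cdots\alpha_n$ (letters $\alpha_i$), $\alpha_{1,k}=\alpha_1\cdots\alpha_k$, with $\alpha_{1,0}=\omega$. For $A\subseteq E^0$ and $\alpha\in\mathcal L^{\ge1}$, $r(A,\alpha)=\{r(\lambda)\mid \lambda \text{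 a path},\ \mathcal L(\lambda)=\alpha,\ s(\lambda)\in A\}$; $r(A,\omega)=A$; $r(\alpha)=r(E^0,\alpha)$; $\mathcal L(AE^1)=\{\mathcal L(e)\mid e\in E^1,\ s(e)\in A\}$. Labelled spaces. A labelled space $(E,\mathcal L,\mathcal B)$ is a labelled graph with a family $\mathcal B$ of subsets of $E^0$ closed under finite intersections and finite unions, containing $r(\alpha)$ for all $\alpha\in\mathcal L^{\ge1}$, and such that $r(A,\alpha)\in\mathcal B$ for all $A\in\mathcal B$, $\alpha\in\mathcal L^*$. It is normal if it is weakly left-resolving, i.e. $r(A\cap B,\alpha)=r(A,\alpha)\cap r(B,\alpha)$ for all $A,B\in\mathcal B$, $\alpha\in\mathcal L^{\ge1}$, and $\mathcal B$ is closed under relative complements. A nonempty $A\in\mathcal B$ is regular if $0<|\mathcal L(BE^1)|<\infty$ for every nonempty $B\in\mathcal B$ with $B\subseteq A$; $\mathcal B_{\mathrm{reg}}$ is the set of regular elements together with $\emptyset$. For $\alpha\in\mathcal L^*$, $\mathcal B_\alpha=\{A\in\mathcal B\mid A\subseteq r(\alpha)\}$. The algebra. $L_K(E,\mathcal L,\mathcal B)$ (Leavitt labelled path algebra) is the universal (associative, not necessarily unital) $K$-algebra with generators $\{p_A\mid A\in\mathcal B\}$ and $\{s_a,s_a^*\mid a\in\mathcal A\}$ and relations: (i) $p_{A\cap B}=p_Ap_B$, $p_{A\cup B}=p_A+p_B-p_{A\cap B}$, $p_\emptyset=0$ for $A,B\in\mathcal B$; (ii) $p_As_a=s_ap_{r(A,a)}$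 and $s_a^*p_A=p_{r(A,a)}s_a^*$ for $A\in\mathcal B$, $a\in\mathcal A$; (iii) $s_a^*s_a=p_{r(a)}$, and $s_b^*s_a=0$ if $b\ne a$; (iv) $s_as_a^*s_a=s_a$ and $s_a^*s_as_a^*=s_a^*$; (v) $p_A=\sum_{a\in\mathcal L(AE^1)}s_ap_{r(A,a)}s_a^*$ for every $A\in\mathcal B_{\mathrm{reg}}$. Cycles. A pair $(\alpha,A)$ with $\alpha\in\mathcal L^{\ge1}$ and $A\in\mathcal B_\alpha$ nonempty is a cycle if $B\subseteq r(B,\alpha)$ for every $B\in\mathcal B_\alpha$ with $B\subseteq A$. A cycle $(\alpha,A)$ has an exit if there exist $0\le k\le|\alpha|$ and a nonempty $B\in\mathcal B$ such that $B\subseteq r(A,\alpha_{1,k})$ and $\mathcal L(BE^1)\ne\{\alpha_{k+1}\}$, where $\alpha_{|\alpha|+1}:=\alpha_1$. *)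

theory Defs
  imports
    "Graph_Theory.Arc_Walk"
    "HOL-Library.Poly_Mapping"
    "HOL-Algebra.Algebraic_Closure_Type"
begin

section \<open>Labelled spaces\<close>

text \<open>
  The source and range maps of a directed graph are \<^const>\<open>tail\<close> and \<^const>\<open>head\<close>. A path of
  length \<open>n \<ge> 1\<close> is a nonempty arc walk, and words over the alphabet are lists.
\<close>

locale labelled_graph = wf_digraph G
  for G :: "('v, 'e) pre_digraph" +
  fixes lab :: "'e \<Rightarrow> 'a" and alph :: "'a set"
  assumes verts_nonempty: "verts G \<noteq> {}"
    and lab_onto: "lab ` arcs G = alph"
    and alph_nonempty: "alph \<noteq> {}"

definition words1 :: "('v, 'e) pre_digraph \<Rightarrow> ('e \<Rightarrow> 'a) \<Rightarrow> 'a list set" where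
  "words1 G lab = {map lab p | u p v. p \<noteq> [] \<and> pre_digraph.awalk G u p v}"

definition words :: "('v, 'e) pre_digraph \<Rightarrow> ('e \<Rightarrow> 'a) \<Rightarrow> 'a list set" where
  "words G lab = words1 G lab \<union> {[]}"

definition rel_range :: "('v, 'e) pre_digraph \<Rightarrow> ('e \<Rightarrow> 'a) \<Rightarrow> 'v set \<Rightarrow> 'a list \<Rightarrow> 'v set" where
  "rel_range G lab A w =
    (if w = [] then A
     else {v. \<exists>u p. p \<noteq> [] \<and> pre_digraph.awalk G u p v \<and> map lab p = w \<and> u \<in> A})"

abbreviation word_range :: "('v, 'e) pre_digraph \<Rightarrow> ('e \<Rightarrow> 'a) \<Rightarrow> 'a list \<Rightarrow> 'v set" where
  "word_range G lab w \<equiv> rel_range G lab (verts G) w"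

definition labels_from :: "('v, 'e) pre_digraph \<Rightarrow> ('e \<Rightarrow> 'a) \<Rightarrow> 'v set \<Rightarrow> 'a set" where
  "labels_from G lab A = {lab e | e. e \<in> arcs G \<and> tail G e \<in> A}"

locale labelled_space = labelled_graph G lab alph
  for G :: "('v, 'e) pre_digraph" and lab :: "'e \<Rightarrow> 'a" and alph :: "'a set" +
  fixes BB :: "'v set set"
  assumes BB_subset: "A \<in> BB \<Longrightarrow> A \<subseteq> verts G"
    and Int_closed: "\<lbrakk>A \<in> BB; B \<in> BB\<rbrakk> \<Longrightarrow> A \<inter> B \<in> BB"
    and Un_closed: "\<lbrakk>A \<in> BB; B \<in> BB\<rbrakk> \<Longrightarrow> A \<union> B \<in> BB"
    and word_range_closed: "w \<in> words1 G lab \<Longrightarrow> word_range G lab w \<in> BB"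
    and rel_range_closed: "\<lbrakk>A \<in> BB; w \<in> words G lab\<rbrakk> \<Longrightarrow> rel_range G lab A w \<in> BB"

text \<open>
  Closure under relative complements gives \<open>{} \<in> BB\<close>, since \<open>BB\<close> contains the range of every
  letter and the alphabet is nonempty.
\<close>

locale normal_labelled_space = labelled_space +
  assumes weakly_left_resolving:
      "\<lbrakk>A \<in> BB; B \<in> BB; w \<in> words1 G lab\<rbrakk> \<Longrightarrow>
        rel_range G lab (A \<inter> B) w = rel_range G lab A w \<inter> rel_range G lab B w"
    and Diff_closed: "\<lbrakk>A \<in> BB; B \<in> BB\<rbrakk> \<Longrightarrow> A - B \<in> BB"

definition regular :: "('v, 'e) pre_digraph \<Rightarrow> ('e \<Rightarrow> 'a) \<Rightarrow> 'v set set \<Rightarrow> 'v set \<Rightarrow> bool" where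
  "regular G lab BB A \<longleftrightarrow> A \<in> BB \<and> A \<noteq> {} \<and>
    (\<forall>B\<in>BB. B \<noteq> {} \<and> B \<subseteq> A \<longrightarrow>
      finite (labels_from G lab B) \<and> 0 < card (labels_from G lab B))"

definition BB_reg :: "('v, 'e) pre_digraph \<Rightarrow> ('e \<Rightarrow> 'a) \<Rightarrow> 'v set set \<Rightarrow> 'v set set" where
  "BB_reg G lab BB = {A. regular G lab BB A} \<union> {{}}"

definition BB_word ::
  "('v, 'e) pre_digraph \<Rightarrow> ('e \<Rightarrow> 'a) \<Rightarrow> 'v set set \<Rightarrow> 'a list \<Rightarrow> 'v set set" where
  "BB_word G lab BB w = {A \<in> BB. A \<subseteq> word_range G lab w}"

definition is_cycle ::
  "('v, 'e) pre_digraph \<Rightarrow> ('e \<Rightarrow> 'a) \<Rightarrow> 'v set set \<Rightarrow> 'a list \<Rightarrow> 'v set \<Rightarrow> bool" where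
  "is_cycle G lab BB w A \<longleftrightarrow>
    w \<in> words1 G lab \<and> A \<in> BB_word G lab BB w \<and> A \<noteq> {} \<and>
    (\<forall>B \<in> BB_word G lab BB w. B \<subseteq> A \<longrightarrow> B \<subseteq> rel_range G lab B w)"

text \<open>
  List positions start at 0, so the letter numbered \<open>k + 1\<close> is \<open>(w @ [hd w]) ! k\<close>; the
  appended first letter implements the convention for \<open>k = length w\<close>.
\<close>

definition cycle_has_exit ::
  "('v, 'e) pre_digraph \<Rightarrow> ('e \<Rightarrow> 'a) \<Rightarrow> 'v set set \<Rightarrow> 'a list \<Rightarrow> 'v set \<Rightarrow> bool" where
  "cycle_has_exit G lab BB w A \<longleftrightarrow>
    (\<exists>k \<le> length w. \<exists>B \<in> BB. B \<noteq> {} \<and> B \<subseteq> rel_range G lab A (take k w) \<and>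
      labels_from G lab B \<noteq> {(w @ [hd w]) ! k})"


section \<open>Associative algebras without unit\<close>

text \<open>
  An associative, not necessarily unital algebra over a field (given by a type of class
  \<^class>\<open>field\<close>) is a module with a bilinear associative product. The component \<^const>\<open>one\<close> of the
  record carries no meaning here.
\<close>

locale assoc_algebra = module "ring_of_type_algebra :: 'k::field ring" A
  for A :: "('k::field, 'b) module" (structure) +
  assumes mult_closed: "\<lbrakk>x \<in> carrier A; y \<in> carrier A\<rbrakk> \<Longrightarrow> x \<otimes>\<^bsub>A\<^esub> y \<in> carrier A"
    and mult_assoc: "\<lbrakk>x \<in> carrier A; y \<in> carrier A; z \<in> carrier A\<rbrakk> \<Longrightarrow>
      (x \<otimes>\<^bsub>A\<^esub> y) \<otimes>\<^bsub>A\<^esub> z = x \<otimes>\<^bsub>A\<^esub> (y \<otimes>\<^bsub>A\<^esub> z)"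
    and mult_l_distr: "\<lbrakk>x \<in> carrier A; y \<in> carrier A; z \<in> carrier A\<rbrakk> \<Longrightarrow>
      (x \<oplus>\<^bsub>A\<^esub> y) \<otimes>\<^bsub>A\<^esub> z = x \<otimes>\<^bsub>A\<^esub> z \<oplus>\<^bsub>A\<^esub> y \<otimes>\<^bsub>A\<^esub> z"
    and mult_r_distr: "\<lbrakk>x \<in> carrier A; y \<in> carrier A; z \<in> carrier A\<rbrakk> \<Longrightarrow>
      z \<otimes>\<^bsub>A\<^esub> (x \<oplus>\<^bsub>A\<^esub> y) = z \<otimes>\<^bsub>A\<^esub> x \<oplus>\<^bsub>A\<^esub> z \<otimes>\<^bsub>A\<^esub> y"
    and smult_mult_left: "\<lbrakk>x \<in> carrier A; y \<in> carrier A\<rbrakk> \<Longrightarrow>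
      (c \<odot>\<^bsub>A\<^esub> x) \<otimes>\<^bsub>A\<^esub> y = c \<odot>\<^bsub>A\<^esub> (x \<otimes>\<^bsub>A\<^esub> y)"
    and smult_mult_right: "\<lbrakk>x \<in> carrier A; y \<in> carrier A\<rbrakk> \<Longrightarrow>
      x \<otimes>\<^bsub>A\<^esub> (c \<odot>\<^bsub>A\<^esub> y) = c \<odot>\<^bsub>A\<^esub> (x \<otimes>\<^bsub>A\<^esub> y)"

definition algebra_hom :: "('k, 'b) module \<Rightarrow> ('k, 'c) module \<Rightarrow> ('b \<Rightarrow> 'c) set" where
  "algebra_hom A B = {h \<in> carrier A \<rightarrow> carrier B.
    (\<forall>x\<in>carrier A. \<forall>y\<in>carrier A. h (x \<oplus>\<^bsub>A\<^esub> y) = h x \<oplus>\<^bsub>B\<^esub> h y) \<and>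
    (\<forall>x\<in>carrier A. \<forall>y\<in>carrier A. h (x \<otimes>\<^bsub>A\<^esub> y) = h x \<otimes>\<^bsub>B\<^esub> h y) \<and>
    (\<forall>c. \<forall>x\<in>carrier A. h (c \<odot>\<^bsub>A\<^esub> x) = c \<odot>\<^bsub>B\<^esub> h x)}"


section \<open>Algebras given by generators and relations\<close>

text \<open>
  Words under concatenation, written additively so that \<open>'x fword \<Rightarrow>\<^sub>0 'k\<close> is the free unital
  algebra: the convolution product of \<^theory>\<open>HOL-Library.Poly_Mapping\<close> is the monoid-algebra
  product. The addition on \<open>fword\<close> is not commutative.
\<close>

datatype 'x fword = FWord (letters: "'x list")

instantiation fword :: (type) monoid_add
begin

definition zero_fword :: "'a fword" where "0 = FWord []"

definition plus_fword :: "'a fword \<Rightarrow> 'a fword \<Rightarrow> 'a fword" where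
  "u + v = FWord (letters u @ letters v)"

instance
  by standard (simp_all add: zero_fword_def plus_fword_def)

end

definition gen :: "'x \<Rightarrow> ('x fword \<Rightarrow>\<^sub>0 'k::field)" where
  "gen x = Poly_Mapping.single (FWord [x]) 1"

definition scale :: "'k::field \<Rightarrow> ('x fword \<Rightarrow>\<^sub>0 'k) \<Rightarrow> ('x fword \<Rightarrow>\<^sub>0 'k)" where
  "scale c f = Poly_Mapping.single 0 c * f"

text \<open>The free non-unital algebra on \<open>S\<close>: combinations of nonempty words in \<open>S\<close>.\<close>

definition free_algebra :: "'x set \<Rightarrow> ('x fword \<Rightarrow>\<^sub>0 'k::field) set" where
  "free_algebra S = {f. \<forall>w \<in> Poly_Mapping.keys f. letters w \<noteq> [] \<and> set (letters w) \<subseteq> S}"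

text \<open>The two-sided ideal of \<open>free_algebra S\<close> generated by \<open>R\<close>.\<close>

inductive_set rel_ideal ::
  "'x set \<Rightarrow> ('x fword \<Rightarrow>\<^sub>0 'k::field) set \<Rightarrow> ('x fword \<Rightarrow>\<^sub>0 'k) set"
  for S R where
  zero: "0 \<in> rel_ideal S R"
| base: "f \<in> R \<Longrightarrow> f \<in> rel_ideal S R"
| add: "\<lbrakk>f \<in> rel_ideal S R; g \<in> rel_ideal S R\<rbrakk> \<Longrightarrow> f + g \<in> rel_ideal S R"
| scale: "f \<in> rel_ideal S R \<Longrightarrow> scale c f \<in> rel_ideal S R"
| mult_left: "\<lbrakk>f \<in> rel_ideal S R; g \<in> free_algebra S\<rbrakk> \<Longrightarrow> g * f \<in> rel_ideal S R"
| mult_right: "\<lbrakk>f \<in> rel_ideal S R; g \<in> free_algebra S\<rbrakk> \<Longrightarrow> f * g \<in> rel_ideal S R"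

definition ideal_cong ::
  "'x set \<Rightarrow> ('x fword \<Rightarrow>\<^sub>0 'k::field) set \<Rightarrow> (('x fword \<Rightarrow>\<^sub>0 'k) \<times> ('x fword \<Rightarrow>\<^sub>0 'k)) set" where
  "ideal_cong S R =
    {(f, g). f \<in> free_algebra S \<and> g \<in> free_algebra S \<and> f - g \<in> rel_ideal S R}"

definition presented_algebra ::
  "'x set \<Rightarrow> ('x fword \<Rightarrow>\<^sub>0 'k::field) set \<Rightarrow> ('k, ('x fword \<Rightarrow>\<^sub>0 'k) set) module" where
  "presented_algebra S R =
    \<lparr>carrier = free_algebra S // ideal_cong S R,
     monoid.mult = (\<lambda>P Q. \<Union>f\<in>P. \<Union>g\<in>Q. ideal_cong S R `` {f * g}),
     one = undefined,
     ring.zero = ideal_cong S R `` {0},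
     add = (\<lambda>P Q. \<Union>f\<in>P. \<Union>g\<in>Q. ideal_cong S R `` {f + g}),
     module.smult = (\<lambda>c P. \<Union>f\<in>P. ideal_cong S R `` {scale c f})\<rparr>"


section \<open>The Leavitt labelled path algebra\<close>

datatype ('v, 'a) llpa_gen = GP "'v set" | GS 'a | GSstar 'a

definition llpa_gens :: "'a set \<Rightarrow> 'v set set \<Rightarrow> ('v, 'a) llpa_gen set" where
  "llpa_gens alph BB = GP ` BB \<union> GS ` alph \<union> GSstar ` alph"

abbreviation (input) "gP A \<equiv> gen (GP A)"
abbreviation (input) "gS a \<equiv> gen (GS a)"
abbreviation (input) "gT a \<equiv> gen (GSstar a)"

text \<open>A relation \<open>x = y\<close> is recorded as the element \<open>x - y\<close>.\<close>

definition llpa_rels ::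
  "('v, 'e) pre_digraph \<Rightarrow> ('e \<Rightarrow> 'a) \<Rightarrow> 'a set \<Rightarrow> 'v set set \<Rightarrow>
    (('v, 'a) llpa_gen fword \<Rightarrow>\<^sub>0 'k::field) set" where
  "llpa_rels G lab alph BB =
     {gP (A \<inter> B) - gP A * gP B | A B. A \<in> BB \<and> B \<in> BB}
   \<union> {gP (A \<union> B) - (gP A + gP B - gP (A \<inter> B)) | A B. A \<in> BB \<and> B \<in> BB}
   \<union> {gP {}}
   \<union> {gP A * gS a - gS a * gP (rel_range G lab A [a]) | A a. A \<in> BB \<and> a \<in> alph}
   \<union> {gT a * gP A - gP (rel_range G lab A [a]) * gT a | A a. A \<in> BB \<and> a \<in> alph}
   \<union> {gT a * gS a - gP (word_range G lab [a]) | a. a \<in> alph}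
   \<union> {gT b * gS a | a b. a \<in> alph \<and> b \<in> alph \<and> b \<noteq> a}
   \<union> {gS a * gT a * gS a - gS a | a. a \<in> alph}
   \<union> {gT a * gS a * gT a - gT a | a. a \<in> alph}
   \<union> {gP A - (\<Sum>a\<in>labels_from G lab A. gS a * gP (rel_range G lab A [a]) * gT a)
        | A. A \<in> BB_reg G lab BB}"

definition LLPA ::
  "('v, 'e) pre_digraph \<Rightarrow> ('e \<Rightarrow> 'a) \<Rightarrow> 'a set \<Rightarrow> 'v set set \<Rightarrow>
    ('k::field, (('v, 'a) llpa_gen fword \<Rightarrow>\<^sub>0 'k) set) module" where
  "LLPA G lab alph BB = presented_algebra (llpa_gens alph BB) (llpa_rels G lab alph BB)"

definition LLPA_p ::
  "('v, 'e) pre_digraph \<Rightarrow> ('e \<Rightarrow> 'a) \<Rightarrow> 'a set \<Rightarrow> 'v set set \<Rightarrow> 'v set \<Rightarrow>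
    (('v, 'a) llpa_gen fword \<Rightarrow>\<^sub>0 'k::field) set" where
  "LLPA_p G lab alph BB A =
    ideal_cong (llpa_gens alph BB) (llpa_rels G lab alph BB) `` {gen (GP A)}"

end

theory Submission
  imports Defs
begin

text \<open>
  Write \<open>L\<close> for the Leavitt labelled path algebra and \<open>p\<^sub>B\<close>, \<open>s\<^sub>a\<close>, \<open>s\<^sub>a\<^sup>*\<close> for its generators. The two
  implications have independent proofs.

  If \<open>\<phi>\<close> is injective, \<open>\<phi>(p\<^sub>B) \<noteq> 0\<close> follows from \<open>p\<^sub>B \<noteq> 0\<close> in \<open>L\<close>, for which a representation of \<open>L\<close> is
  needed. Vertices do not suffice as its points: a vertex of a regular set may emit no edge, if no
  nonempty member of \<open>BB\<close> consists of such vertices. Prime filters of \<open>BB\<close> in place of vertices remedy this,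
  because a prime filter that contains a regular set can always be continued along some letter
  (\<open>prime_filter_lifts\<close>). The algebra acts on functions on the resulting boundary paths by restriction,
  prefixing and removal of letters, and a path starting in \<open>B\<close> shows that \<open>p\<^sub>B\<close> acts nontrivially
  (\<open>projection_not_in_rel_ideal\<close>).

  For the converse, every nonzero ideal of \<open>L\<close> is shown to contain some \<open>p\<^sub>B\<close> with \<open>B\<close> nonempty
  (\<open>nonzero_ideal_contains_projection\<close>). \<open>L\<close> is spanned by the elements \<open>s\<^sub>\<alpha> p\<^sub>A s\<^sub>\<beta>\<^sup>*\<close>. Given a nonzero element,
  multiply by letters on the right as long as the product stays nonzero; this shortens the words \<open>\<beta>\<close>. When
  all further products vanish, the relation for regular sets forces the element to live on a nonregular set,
  that is, on a set with infinitely many labels or with none, and there the terms with nonempty \<open>\<beta>\<close> can be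
  made to disappear. What remains is a combination of elements \<open>s\<^sub>\<alpha> p\<^sub>C\<close> with a common \<open>C\<close> and distinct words
  \<open>\<alpha>\<close>. Multiplying by \<open>s\<^sup>*\<close> of a shortest word gives \<open>c p\<^sub>C\<close> plus terms \<open>s\<^sub>\<gamma> p\<^sub>D\<close> with \<open>\<gamma>\<close> nonempty. Each of
  these terms is killed by a compression \<open>x \<mapsto> p s\<^sub>\<delta>\<^sup>* x s\<^sub>\<delta> p\<close> that preserves the leading term: either some set is
  disjoint from its range under \<open>\<gamma>\<close>, or \<open>\<gamma>\<close> is a cycle, and \<open>\<delta>\<close> follows it to an exit and leaves it there
  (\<open>aperiodic_piece\<close>, \<open>projection_of_polynomial\<close>).

  This reduction is carried out for any family satisfying the relations in a unital ring. It is applied to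
  the quotient of the free algebra by the ideal of relations, realised inside a ring type.
\<close>

section \<open>Ranges of words and cycles with exits\<close>

lemma nonsingleton_other: "L \<noteq> {} \<Longrightarrow> L \<noteq> {x} \<Longrightarrow> \<exists>y\<in>L. y \<noteq> x"
  by auto

lemma (in wf_digraph) rel_range_append:
  assumes "A \<subseteq> verts G"
  shows "rel_range G lab A (u @ v) = rel_range G lab (rel_range G lab A u) v"
proof (cases "u = [] \<or> v = []")
  case True
  then show ?thesis by (auto simp: rel_range_def)
next
  case False
  show ?thesis
  proof (intro equalityI subsetI)
    fix x assume "x \<in> rel_range G lab A (u @ v)"
    then obtain y p where p: "awalk y p x" "map lab p = u @ v" "y \<in> A"
      using False by (auto simp: rel_range_def)
    from p(2) obtain q q' where q: "p = q @ q'" "map lab q = u" "map lab q' = v"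
      by (auto simp: map_eq_append_conv)
    with p(1) obtain z where z: "awalk y q z" "awalk z q' x" by auto
    have "z \<in> rel_range G lab A u" using z(1) q p(3) False by (auto simp: rel_range_def)
    then show "x \<in> rel_range G lab (rel_range G lab A u) v"
      unfolding rel_range_def[of G lab "rel_range G lab A u"] using z(2) q False by auto
  next
    fix x assume "x \<in> rel_range G lab (rel_range G lab A u) v"
    then obtain z q' where q': "awalk z q' x" "map lab q' = v" "z \<in> rel_range G lab A u"
      using False unfolding rel_range_def[of G lab "rel_range G lab A u"] by auto
    then obtain y q where q: "awalk y q z" "map lab q = u" "y \<in> A"
      using False by (auto simp: rel_range_def)
    have "awalk y (q @ q') x" using q q' by auto
    then have "\<exists>y p. p \<noteq> [] \<and> awalk y p x \<and> map lab p = u @ v \<and> y \<in> A"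
      using q q' False by (intro exI[of _ y] exI[of _ "q @ q'"]) auto
    then show "x \<in> rel_range G lab A (u @ v)" using False by (auto simp: rel_range_def)
  qed
qed

lemma (in wf_digraph) labels_from_iff_range:
  "a \<in> labels_from G lab A \<longleftrightarrow> rel_range G lab A [a] \<noteq> {}"
proof
  assume "a \<in> labels_from G lab A"
  then obtain e where "e \<in> arcs G" "tail G e \<in> A" "lab e = a"
    by (auto simp: labels_from_def)
  then have "head G e \<in> rel_range G lab A [a]"
    by (auto simp: rel_range_def awalk_Cons_iff awalk_Nil_iff intro!: exI[of _ "[e]"])
  then show "rel_range G lab A [a] \<noteq> {}" by auto
next
  assume "rel_range G lab A [a] \<noteq> {}"
  then show "a \<in> labels_from G lab A"
    by (auto simp: rel_range_def labels_from_def awalk_Cons_iff map_eq_Cons_conv)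
qed

lemma rel_range_mono: "A \<subseteq> B \<Longrightarrow> rel_range G lab A w \<subseteq> rel_range G lab B w"
  by (auto simp: rel_range_def)

lemma rel_range_Un: "rel_range G lab (A \<union> B) w = rel_range G lab A w \<union> rel_range G lab B w"
  by (auto simp: rel_range_def)

lemma rel_range_empty [simp]: "rel_range G lab {} w = {}"
  by (auto simp: rel_range_def)

lemma rel_range_Nil [simp]: "rel_range G lab A [] = A"
  by (simp add: rel_range_def)

lemma (in wf_digraph) rel_range_subset_verts:
  "A \<subseteq> verts G \<Longrightarrow> rel_range G lab A w \<subseteq> verts G"
  by (auto simp: rel_range_def)

context labelled_space
begin

lemma labels_from_subset: "labels_from G lab A \<subseteq> alph"
  using lab_onto by (auto simp: labels_from_def)

lemma words1I: "rel_range G lab A w \<noteq> {} \<Longrightarrow> w \<noteq> [] \<Longrightarrow> w \<in> words1 G lab"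
  by (force simp: rel_range_def words1_def)

lemma letter_in_words1: "a \<in> alph \<Longrightarrow> [a] \<in> words1 G lab"
proof -
  assume "a \<in> alph"
  then have "a \<in> labels_from G lab (verts G)"
    using lab_onto by (auto simp: labels_from_def)
  then show ?thesis by (intro words1I) (auto simp: labels_from_iff_range)
qed

end

context normal_labelled_space
begin

lemma empty_in_BB: "{} \<in> BB"
proof -
  obtain a where "a \<in> alph" using alph_nonempty by auto
  then have "word_range G lab [a] \<in> BB" by (intro word_range_closed letter_in_words1)
  from Diff_closed[OF this this] show ?thesis by simp
qed

lemma rel_range_in_BB: "A \<in> BB \<Longrightarrow> rel_range G lab A w \<in> BB"
  using rel_range_closed[of A w] words1I[of A w] empty_in_BB
  by (cases "rel_range G lab A w = {}"; cases "w = []") (auto simp: words_def)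

lemma word_range_in_BB: "w \<noteq> [] \<Longrightarrow> word_range G lab w \<in> BB"
  using word_range_closed[of w] words1I[of "verts G" w] empty_in_BB
  by (cases "word_range G lab w = {}") auto

lemma Int_word_range_in_BB: "A \<in> BB \<Longrightarrow> A \<inter> word_range G lab w \<in> BB"
  using Int_closed[of A "word_range G lab w"] word_range_in_BB[of w] BB_subset[of A]
  by (cases "w = []") (auto simp: Int_absorb2)

lemma rel_range_Int:
  assumes "A \<in> BB" "B \<in> BB"
  shows "rel_range G lab (A \<inter> B) w = rel_range G lab A w \<inter> rel_range G lab B w"
proof (cases "w = [] \<or> w \<in> words1 G lab")
  case True
  then show ?thesis using assms weakly_left_resolving by auto
next
  case False
  then have "rel_range G lab C w = {}" for C using words1I by blast
  then show ?thesis by simp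
qed

lemma rel_range_append_BB:
  "A \<in> BB \<Longrightarrow> rel_range G lab A (u @ v) = rel_range G lab (rel_range G lab A u) v"
  by (rule rel_range_append) (rule BB_subset)

lemma rel_range_Cons_BB:
  "A \<in> BB \<Longrightarrow> rel_range G lab A (a # v) = rel_range G lab (rel_range G lab A [a]) v"
  using rel_range_append_BB[of A "[a]" v] by simp

lemma word_range_append:
  "word_range G lab (u @ v) = rel_range G lab (word_range G lab u) v"
  by (rule rel_range_append) simp

lemma word_range_append_subset: "word_range G lab (u @ v) \<subseteq> word_range G lab v"
  unfolding word_range_append by (intro rel_range_mono rel_range_subset_verts) simp

lemma rel_range_no_labels:
  assumes "C \<in> BB" "labels_from G lab C = {}" "w \<noteq> []"
  shows "rel_range G lab C w = {}"
proof -
  obtain a v where w: "w = a # v" using assms(3) by (cases w) auto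
  have "rel_range G lab C [a] = {}" using assms(2) labels_from_iff_range[of a lab C] by simp
  then show ?thesis using rel_range_Cons_BB[OF assms(1), of a v] w by simp
qed

lemma nonregular_piece:
  assumes "C \<in> BB" "C \<noteq> {}" "\<not> regular G lab BB C"
  obtains B where "B \<in> BB" "B \<noteq> {}" "B \<subseteq> C"
    "infinite (labels_from G lab B) \<or> labels_from G lab B = {}"
  using assms by (auto simp: regular_def card_gt_0_iff)

text \<open>This is the only place where exits are used. If no nonempty \<open>C \<subseteq> B\<close> is disjoint from its range under
\<open>\<gamma>\<close>, then every \<open>D \<subseteq> B\<close> satisfies \<open>D \<subseteq> r(D, \<gamma>)\<close>, since \<open>D - r(D, \<gamma>)\<close> would be disjoint from its
own range; so \<open>(\<gamma>, B)\<close> is a cycle. Follow it up to an exit. If the exit is a set that emits nothing,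
ranges of that set under nonempty words are empty. Otherwise leave the cycle along a wrong letter \<open>b\<close>:
then \<open>\<gamma> @ \<delta>\<close> and \<open>\<delta>\<close> differ at the position of \<open>b\<close>, so no \<open>\<epsilon>\<close> with \<open>\<gamma> @ \<delta> = \<delta> @ \<epsilon>\<close> exists.

In the algebra, \<open>p\<^sub>C s\<^sub>\<delta>\<^sup>* s\<^sub>\<gamma> s\<^sub>\<delta> p\<^sub>C\<close> equals \<open>p\<^sub>C s\<^sub>\<epsilon> p\<^sub>C\<close> if \<open>\<gamma> @ \<delta> = \<delta> @ \<epsilon>\<close>, and \<open>0\<close> if there is no such
\<open>\<epsilon>\<close>; the disjointness makes it vanish in the first case too.\<close>

lemma aperiodic_piece:
  assumes exits: "\<And>w C. is_cycle G lab BB w C \<Longrightarrow> cycle_has_exit G lab BB w C"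
    and B: "B \<in> BB" "B \<noteq> {}" and \<gamma>: "\<gamma> \<noteq> []" "\<gamma> \<in> lists alph"
  obtains \<delta> C where "\<delta> \<in> lists alph" "C \<in> BB" "C \<noteq> {}" "C \<subseteq> rel_range G lab B \<delta>"
    "\<And>\<epsilon>. \<gamma> @ \<delta> = \<delta> @ \<epsilon> \<Longrightarrow> C \<inter> rel_range G lab C \<epsilon> = {}"
proof (cases "\<exists>C\<in>BB. C \<noteq> {} \<and> C \<subseteq> B \<and> C \<inter> rel_range G lab C \<gamma> = {}")
  case True
  then obtain C where "C \<in> BB" "C \<noteq> {}" "C \<subseteq> B" "C \<inter> rel_range G lab C \<gamma> = {}" by blast
  then show thesis by (intro that[of "[]" C]) auto
next
  case False
  have sub: "D \<subseteq> rel_range G lab D \<gamma>" if D: "D \<in> BB" "D \<subseteq> B" for D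
  proof (rule ccontr)
    assume n: "\<not> D \<subseteq> rel_range G lab D \<gamma>"
    \<comment> \<open>The failure \<open>?E\<close> of the inclusion is disjoint from its own range.\<close>
    let ?E = "D - rel_range G lab D \<gamma>"
    have "?E \<in> BB" using D by (intro Diff_closed rel_range_in_BB)
    moreover have "?E \<inter> rel_range G lab ?E \<gamma> = {}"
      using rel_range_mono[of ?E D G lab \<gamma>] by auto
    moreover have "?E \<noteq> {}" "?E \<subseteq> B" using n D by auto
    ultimately have "\<exists>C\<in>BB. C \<noteq> {} \<and> C \<subseteq> B \<and> C \<inter> rel_range G lab C \<gamma> = {}"
      by (intro bexI[of _ ?E] conjI)
    then show False using False by simp
  qed
  have range: "B \<subseteq> word_range G lab \<gamma>"
    using sub[OF B(1) order_refl] rel_range_mono[OF BB_subset[OF B(1)], of G lab \<gamma>] by auto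
  then have "\<gamma> \<in> words1 G lab" using B \<gamma> by (intro words1I) auto
  then have "is_cycle G lab BB \<gamma> B" using B range sub by (auto simp: is_cycle_def BB_word_def)
  from exits[OF this] obtain k C0 where k: "k \<le> length \<gamma>" and
    C0: "C0 \<in> BB" "C0 \<noteq> {}" "C0 \<subseteq> rel_range G lab B (take k \<gamma>)"
      "labels_from G lab C0 \<noteq> {(\<gamma> @ [hd \<gamma>]) ! k}"
    by (auto simp: cycle_has_exit_def)
  have tk: "take k \<gamma> \<in> lists alph" using \<gamma>(2) by (auto dest: in_set_takeD)
  show thesis
  proof (cases "labels_from G lab C0 = {}")
    case True
    have "C0 \<inter> rel_range G lab C0 \<epsilon> = {}" if "\<gamma> @ take k \<gamma> = take k \<gamma> @ \<epsilon>" for \<epsilon>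
    proof -
      have "length (\<gamma> @ take k \<gamma>) = length (take k \<gamma> @ \<epsilon>)" using that by simp
      then have "\<epsilon> \<noteq> []" using \<gamma>(1) by auto
      then show ?thesis using rel_range_no_labels[OF C0(1) True] by simp
    qed
    then show thesis by (rule that[OF tk C0(1-3)])
  next
    case False
    from nonsingleton_other[OF this C0(4)]
    obtain b where b: "b \<in> labels_from G lab C0" "b \<noteq> (\<gamma> @ [hd \<gamma>]) ! k"
      by (elim bexE)
    \<comment> \<open>Position \<open>k\<close> of \<open>\<gamma> @ take k \<gamma>\<close> is the next letter of the cycle, with wrap-around at the end; \<open>b\<close> differs from it.\<close>
    have no: False if "\<gamma> @ take k \<gamma> @ [b] = (take k \<gamma> @ [b]) @ \<epsilon>" for \<epsilon>
    proof -
      from that have "(\<gamma> @ take k \<gamma> @ [b]) ! k = (take k \<gamma> @ b # \<epsilon>) ! k" by simp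
      moreover have "(take k \<gamma> @ b # \<epsilon>) ! k = b" using k by (simp add: nth_append)
      moreover have "(\<gamma> @ take k \<gamma> @ [b]) ! k = (\<gamma> @ [hd \<gamma>]) ! k"
      proof (cases "k < length \<gamma>")
        case False
        then have "k = length \<gamma>" using k by simp
        then show ?thesis using \<gamma>(1) by (simp add: nth_append hd_conv_nth)
      qed (simp add: nth_append)
      ultimately show False using b by simp
    qed
    show thesis
    proof (rule that[of "take k \<gamma> @ [b]" "rel_range G lab C0 [b]"])
      show "rel_range G lab C0 [b] \<noteq> {}" using b(1) by (simp add: labels_from_iff_range)
      show "rel_range G lab C0 [b] \<subseteq> rel_range G lab B (take k \<gamma> @ [b])"
        using rel_range_append_BB[OF B(1)] rel_range_mono[OF C0(3)] by simp
      show "take k \<gamma> @ [b] \<in> lists alph" using tk b(1) labels_from_subset by auto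
      show "rel_range G lab C0 [b] \<in> BB" using C0(1) by (rule rel_range_in_BB)
    next
      fix \<epsilon> assume "\<gamma> @ take k \<gamma> @ [b] = (take k \<gamma> @ [b]) @ \<epsilon>"
      from no[OF this] show "rel_range G lab C0 [b] \<inter> rel_range G lab (rel_range G lab C0 [b]) \<epsilon> = {}" ..
    qed
  qed
qed

end

section \<open>Actions of free algebras\<close>

lemma poly_mapping_additive_induct [case_names zero single add]:
  fixes f :: "'x \<Rightarrow>\<^sub>0 'k::comm_monoid_add"
  assumes "P 0" "\<And>w c. P (Poly_Mapping.single w c)" "\<And>f g. P f \<Longrightarrow> P g \<Longrightarrow> P (f + g)"
  shows "P f"
proof (induction f rule: update_induct)
  case const
  show ?case using assms(1) .
next
  case (update f a b)
  have "Poly_Mapping.update a b f = f + Poly_Mapping.single a b"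
    using update(1)
    by (intro poly_mapping_eqI)
      (auto simp: lookup_update lookup_add lookup_single when_def in_keys_iff)
  then show ?case using assms(2,3) update by simp
qed

text \<open>A choice of linear operators for the generators makes a space of functions a module over the free
algebra. An element that acts nontrivially, while all relations act as zero, lies outside the ideal of
relations.\<close>

locale generator_action =
  fixes \<rho> :: "'x \<Rightarrow> ('m \<Rightarrow> 'k::field) \<Rightarrow> 'm \<Rightarrow> 'k"
  assumes op_add: "\<rho> x (\<lambda>m. g m + h m) = (\<lambda>m. \<rho> x g m + \<rho> x h m)"
    and op_scale: "\<rho> x (\<lambda>m. c * g m) = (\<lambda>m. c * \<rho> x g m)"
begin

definition act :: "('x fword \<Rightarrow>\<^sub>0 'k) \<Rightarrow> ('m \<Rightarrow> 'k) \<Rightarrow> 'm \<Rightarrow> 'k" where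
  "act f g m = (\<Sum>w\<in>Poly_Mapping.keys f. Poly_Mapping.lookup f w * foldr \<rho> (letters w) g m)"

lemma act_superset:
  "finite W \<Longrightarrow> Poly_Mapping.keys f \<subseteq> W \<Longrightarrow>
    act f g m = (\<Sum>w\<in>W. Poly_Mapping.lookup f w * foldr \<rho> (letters w) g m)"
  unfolding act_def by (rule sum.mono_neutral_left) (auto simp: in_keys_iff)

lemma act_zero: "act 0 g = (\<lambda>m. 0)"
  by (simp add: act_def fun_eq_iff)

lemma act_single: "act (Poly_Mapping.single w c) g = (\<lambda>m. c * foldr \<rho> (letters w) g m)"
  by (rule ext, subst act_superset[of "{w}"]) auto

lemma act_add: "act (f + h) g = (\<lambda>m. act f g m + act h g m)"
proof
  fix m
  let ?W = "Poly_Mapping.keys f \<union> Poly_Mapping.keys h"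
  show "act (f + h) g m = act f g m + act h g m"
    using keys_add[of f h]
    by (simp add: act_superset[of ?W] lookup_add algebra_simps sum.distrib)
qed

lemma act_diff: "act (f - h) g = (\<lambda>m. act f g m - act h g m)"
  using act_add[of "f - h" h g] by (simp add: fun_eq_iff)

lemma act_sum: "act (\<Sum>i\<in>I. f i) g = (\<lambda>m. \<Sum>i\<in>I. act (f i) g m)"
  by (induction I rule: infinite_finite_induct) (simp_all add: act_zero act_add)

lemma act_gen: "act (gen x) g = \<rho> x g"
  by (simp add: gen_def act_single fun_eq_iff)

lemma op_zero: "\<rho> x (\<lambda>m. 0) = (\<lambda>m. 0)"
  using op_scale[of x 0 "\<lambda>m. 0"] by simp

lemma word_op_zero: "foldr \<rho> ws (\<lambda>m. 0) = (\<lambda>m. 0)"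
  by (induction ws) (simp_all add: op_zero)

lemma word_op_add: "foldr \<rho> ws (\<lambda>m. g m + h m) = (\<lambda>m. foldr \<rho> ws g m + foldr \<rho> ws h m)"
  by (induction ws) (simp_all add: op_add)

lemma word_op_scale: "foldr \<rho> ws (\<lambda>m. c * g m) = (\<lambda>m. c * foldr \<rho> ws g m)"
  by (induction ws) (simp_all add: op_scale)

lemma act_op_zero: "act f (\<lambda>m. 0) = (\<lambda>m. 0)"
  by (simp add: act_def word_op_zero fun_eq_iff)

lemma act_mult: "act (f * h) g = act f (act h g)"
proof (induction f rule: poly_mapping_additive_induct)
  case (single u c)
  show ?case
  proof (induction h rule: poly_mapping_additive_induct)
    case (single v d)
    show ?case by (simp add: mult_single act_single plus_fword_def word_op_scale mult.assoc)
  next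
    case (add h h')
    then show ?case by (simp add: algebra_simps act_add act_single word_op_add)
  qed (simp add: act_zero act_op_zero)
qed (simp_all add: act_zero act_add distrib_right)

lemma act_rel_ideal:
  assumes "f \<in> rel_ideal S R" and rels: "\<And>f g. f \<in> R \<Longrightarrow> act f g = (\<lambda>m. 0)"
  shows "act f g = (\<lambda>m. 0)"
  using assms(1)
proof (induction f arbitrary: g rule: rel_ideal.induct)
  case (scale f c)
  then show ?case by (simp add: Defs.scale_def act_mult act_single zero_fword_def)
qed (simp_all add: act_zero act_add act_mult act_op_zero rels)

end

section \<open>Boundary paths and the nonvanishing of projections\<close>

context normal_labelled_space
begin

text \<open>The empty family counts as prime. The edges with a given label may start outside every member of \<open>BB\<close>;
with this convention the pullback of a prime family along a letter is prime without case
distinctions.\<close>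

definition prime_filter where
  "prime_filter \<xi> \<longleftrightarrow> \<xi> \<subseteq> BB \<and> {} \<notin> \<xi> \<and>
    (\<forall>A\<in>BB. \<forall>B\<in>BB. (A \<inter> B \<in> \<xi> \<longleftrightarrow> A \<in> \<xi> \<and> B \<in> \<xi>) \<and> (A \<union> B \<in> \<xi> \<longleftrightarrow> A \<in> \<xi> \<or> B \<in> \<xi>))"

definition pullback where
  "pullback a \<eta> = {A \<in> BB. rel_range G lab A [a] \<in> \<eta>}"

text \<open>A family that is maximal among the intersection-closed families without \<open>{}\<close> above \<open>F\<close> contains every
member of \<open>BB\<close> that meets all its members; primeness follows.\<close>

lemma prime_filter_extends:
  assumes F: "F \<noteq> {}" "F \<subseteq> BB" "{} \<notin> F" "\<And>A B. A \<in> F \<Longrightarrow> B \<in> F \<Longrightarrow> A \<inter> B \<in> F"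
  obtains \<eta> where "prime_filter \<eta>" "F \<subseteq> \<eta>"
proof -
  define \<F> where "\<F> = {H. F \<subseteq> H \<and> H \<subseteq> BB \<and> {} \<notin> H \<and> (\<forall>A\<in>H. \<forall>B\<in>H. A \<inter> B \<in> H)}"
  have "\<exists>M\<in>\<F>. \<forall>Z\<in>\<F>. M \<subseteq> Z \<longrightarrow> Z = M"
  proof (rule subset_Zorn_nonempty)
    have "F \<in> \<F>" using F(2-4) by (simp add: \<F>_def)
    then show "\<F> \<noteq> {}" by (rule ex_in_conv[THEN iffD1, OF exI])
  next
    fix C assume C: "C \<noteq> {}" "subset.chain \<F> C"
    have inter: "A \<inter> B \<in> \<Union>C" if "A \<in> \<Union>C" "B \<in> \<Union>C" for A B
    proof -
      obtain H K where HK: "A \<in> H" "H \<in> C" "B \<in> K" "K \<in> C" using \<open>A \<in> \<Union>C\<close> \<open>B \<in> \<Union>C\<close> by auto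
      then have "H \<subseteq> K \<or> K \<subseteq> H" using C(2) by (auto simp: subset.chain_def)
      then obtain L where "A \<in> L" "B \<in> L" "L \<in> C" using HK by auto
      moreover from this have "L \<in> \<F>" using C(2) by (auto simp: subset.chain_def)
      ultimately show ?thesis by (auto simp: \<F>_def intro!: bexI[of _ L])
    qed
    have "F \<subseteq> H \<and> H \<subseteq> BB \<and> {} \<notin> H" if "H \<in> C" for H
      using C(2) that by (auto simp: subset.chain_def \<F>_def)
    with C(1) inter show "\<Union>C \<in> \<F>" unfolding \<F>_def by blast
  qed
  then obtain M where "M \<in> \<F>" and maximal: "\<And>Z. Z \<in> \<F> \<Longrightarrow> M \<subseteq> Z \<Longrightarrow> Z = M" by auto
  then have M: "F \<subseteq> M" "M \<subseteq> BB" "{} \<notin> M" "\<And>A B. A \<in> M \<Longrightarrow> B \<in> M \<Longrightarrow> A \<inter> B \<in> M"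
    by (auto simp: \<F>_def)
  have mem: "A \<in> M" if A: "A \<in> BB" "A \<noteq> {}" and meets: "\<And>C. C \<in> M \<Longrightarrow> A \<inter> C \<noteq> {}" for A
  proof -
    define H where "H = {Z \<in> BB. \<exists>C\<in>M. A \<inter> C \<subseteq> Z}"
    obtain C where "C \<in> M" using M(1) F(1) by auto
    then have "A \<in> H" using A(1) by (auto simp: H_def)
    have "M \<subseteq> H" using M(2) by (auto simp: H_def)
    moreover have "H \<subseteq> BB" "{} \<notin> H" using meets by (auto simp: H_def)
    moreover have "Y \<inter> Z \<in> H" if YZ: "Y \<in> H" "Z \<in> H" for Y Z
    proof -
      obtain C where C: "C \<in> M" "A \<inter> C \<subseteq> Y" using YZ(1) by (auto simp: H_def)
      obtain D where D: "D \<in> M" "A \<inter> D \<subseteq> Z" using YZ(2) by (auto simp: H_def)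
      have "A \<inter> (C \<inter> D) \<subseteq> Y \<inter> Z" using C(2) D(2) by auto
      then show ?thesis using M(4)[OF C(1) D(1)] YZ Int_closed by (auto simp: H_def)
    qed
    ultimately have "H \<in> \<F>" using M(1) by (auto simp: \<F>_def)
    then show ?thesis using maximal[of H] \<open>M \<subseteq> H\<close> \<open>A \<in> H\<close> by simp
  qed
  have up: "A \<in> M" if "C \<in> M" "C \<subseteq> A" "A \<in> BB" for A C
  proof (rule mem)
    fix D assume "D \<in> M"
    then have "C \<inter> D \<in> M" using M(4) \<open>C \<in> M\<close> by simp
    then show "A \<inter> D \<noteq> {}" using M(3) \<open>C \<subseteq> A\<close> by (metis Int_mono order_refl subset_empty)
  qed (use that M(3) in auto)
  have union: "A \<in> M \<or> B \<in> M" if "A \<in> BB" "B \<in> BB" "A \<union> B \<in> M" for A B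
  proof (rule ccontr)
    assume n: "\<not> (A \<in> M \<or> B \<in> M)"
    have "\<exists>C\<in>M. E \<inter> C = {}" if "E \<in> BB" "E \<notin> M" for E
      using mem[of E] that \<open>A \<union> B \<in> M\<close> by auto
    then obtain C D where "C \<in> M" "A \<inter> C = {}" "D \<in> M" "B \<inter> D = {}"
      using n \<open>A \<in> BB\<close> \<open>B \<in> BB\<close> by meson
    then have "(A \<union> B) \<inter> C \<inter> D = {}" by auto
    moreover have "(A \<union> B) \<inter> C \<inter> D \<in> M" using M(4) \<open>A \<union> B \<in> M\<close> \<open>C \<in> M\<close> \<open>D \<in> M\<close> by simp
    ultimately show False using M(3) by simp
  qed
  have "prime_filter M"
    unfolding prime_filter_def
  proof (intro conjI ballI)
    fix A B assume AB: "A \<in> BB" "B \<in> BB"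
    show "A \<inter> B \<in> M \<longleftrightarrow> A \<in> M \<and> B \<in> M"
      using up[of "A \<inter> B" A] up[of "A \<inter> B" B] M(4) AB by auto
    show "A \<union> B \<in> M \<longleftrightarrow> A \<in> M \<or> B \<in> M"
      using up[of A "A \<union> B"] up[of B "A \<union> B"] union[of A B] AB Un_closed by auto
  qed (use M in auto)
  then show thesis using M(1) that by blast
qed

lemma prime_filter_pullback: "prime_filter \<eta> \<Longrightarrow> prime_filter (pullback a \<eta>)"
  by (auto simp: prime_filter_def pullback_def rel_range_Int rel_range_Un rel_range_in_BB
      Int_closed Un_closed)

text \<open>A compactness argument. A prime family containing a regular set is the pullback of a prime family along
one of the labels of that set: if for each of the finitely many labels \<open>a\<close> of \<open>A\<close> some \<open>C\<^sub>a\<close> in \<open>\<xi>\<close> had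
empty range under \<open>a\<close>, then the intersection of \<open>A\<close> with all \<open>C\<^sub>a\<close> would be a nonempty subset of \<open>A\<close>
that emits nothing. So the ranges of the members of \<open>\<xi>\<close> under some \<open>a\<close> generate a proper family, which
extends to a prime one.\<close>

lemma prime_filter_lifts:
  assumes \<xi>: "prime_filter \<xi>" and A: "A \<in> \<xi>" "regular G lab BB A"
  obtains a \<eta> where "a \<in> alph" "prime_filter \<eta>" "word_range G lab [a] \<in> \<eta>" "\<xi> = pullback a \<eta>"
proof -
  have \<xi>D: "C \<inter> D \<in> \<xi>" if "C \<in> \<xi>" "D \<in> \<xi>" for C D
    using \<xi> that by (auto simp: prime_filter_def)
  have sub: "\<xi> \<subseteq> BB" and ne: "{} \<notin> \<xi>" using \<xi> by (auto simp: prime_filter_def)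
  have "\<exists>a\<in>labels_from G lab A. \<forall>C\<in>\<xi>. rel_range G lab C [a] \<noteq> {}"
  proof (rule ccontr)
    assume "\<not> ?thesis"
    then have "\<forall>a\<in>labels_from G lab A. \<exists>C. C \<in> \<xi> \<and> rel_range G lab C [a] = {}" by auto
    then obtain C where C: "\<And>a. a \<in> labels_from G lab A \<Longrightarrow> C a \<in> \<xi> \<and> rel_range G lab (C a) [a] = {}"
      by metis
    have fin: "finite (labels_from G lab A)" using A(2) by (auto simp: regular_def)
    have "\<exists>D\<in>\<xi>. D \<subseteq> A \<and> (\<forall>a\<in>L. D \<subseteq> C a)" if "finite L" "L \<subseteq> labels_from G lab A" for L
      using that
    proof (induction L rule: finite_induct)
      case empty
      then show ?case using A(1) by auto
    next
      case (insert a L)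
      then obtain D where "D \<in> \<xi>" "D \<subseteq> A" "\<forall>a\<in>L. D \<subseteq> C a" by auto
      then show ?case using \<xi>D[of D "C a"] C[of a] insert.prems
        by (intro bexI[of _ "D \<inter> C a"]) auto
    qed
    from this[OF fin order_refl] obtain D where
      D: "D \<in> \<xi>" "D \<subseteq> A" "\<And>a. a \<in> labels_from G lab A \<Longrightarrow> D \<subseteq> C a" by auto
    have "D \<noteq> {}" "D \<in> BB" using D(1) ne sub by auto
    then have "labels_from G lab D \<noteq> {}" using A(2) D(2) by (auto simp: regular_def)
    then obtain a where a: "a \<in> labels_from G lab D" by auto
    then have "a \<in> labels_from G lab A" using D(2) by (auto simp: labels_from_def)
    then have "rel_range G lab D [a] = {}" using C D(3) rel_range_mono[of D "C a" G lab "[a]"] by auto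
    then show False using a by (simp add: labels_from_iff_range)
  qed
  then obtain a where a: "a \<in> labels_from G lab A" "\<And>C. C \<in> \<xi> \<Longrightarrow> rel_range G lab C [a] \<noteq> {}"
    by auto
  obtain \<eta> where \<eta>: "prime_filter \<eta>" "(\<lambda>C. rel_range G lab C [a]) ` \<xi> \<subseteq> \<eta>"
  proof (rule prime_filter_extends)
    fix Z Y assume "Z \<in> (\<lambda>C. rel_range G lab C [a]) ` \<xi>" "Y \<in> (\<lambda>C. rel_range G lab C [a]) ` \<xi>"
    then obtain C D where "C \<in> \<xi>" "D \<in> \<xi>" "Z = rel_range G lab C [a]" "Y = rel_range G lab D [a]"
      by auto
    moreover from this have "C \<in> BB" "D \<in> BB" using sub by auto
    ultimately show "Z \<inter> Y \<in> (\<lambda>C. rel_range G lab C [a]) ` \<xi>"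
      by (intro image_eqI[of _ _ "C \<inter> D"] \<xi>D) (simp_all add: rel_range_Int)
  next
    show "{} \<notin> (\<lambda>C. rel_range G lab C [a]) ` \<xi>"
    proof
      assume "{} \<in> (\<lambda>C. rel_range G lab C [a]) ` \<xi>"
      then obtain C where "{} = rel_range G lab C [a]" "C \<in> \<xi>" by (rule imageE)
      then show False using a(2)[of C] by simp
    qed
  qed (use A(1) sub rel_range_in_BB in auto)
  have alph: "a \<in> alph" using subsetD[OF labels_from_subset a(1)] .
  have up: "Y \<in> \<eta>" if "Z \<in> \<eta>" "Z \<subseteq> Y" "Y \<in> BB" for Z Y
  proof -
    have "Z \<in> BB" "Z \<inter> Y = Z" using \<eta>(1) that by (auto simp: prime_filter_def)
    then show ?thesis using \<eta>(1) that unfolding prime_filter_def by metis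
  qed
  have r: "word_range G lab [a] \<in> \<eta>"
  proof (rule up[of "rel_range G lab A [a]"])
    show "rel_range G lab A [a] \<in> \<eta>" using \<eta>(2) A(1) by auto
    show "rel_range G lab A [a] \<subseteq> word_range G lab [a]" using A(1) sub
      by (intro rel_range_mono BB_subset) auto
  qed (simp add: word_range_in_BB)
  have "C \<in> \<xi>" if C: "C \<in> pullback a \<eta>" for C
  proof (rule ccontr)
    assume n: "C \<notin> \<xi>"
    have CB: "C \<in> BB" "A \<in> BB" "rel_range G lab C [a] \<in> \<eta>" using C A(1) sub by (auto simp: pullback_def)
    \<comment> \<open>If \<open>C\<close> is not in \<open>\<xi>\<close> then \<open>A - C\<close> is, and the ranges of these disjoint sets are disjoint.\<close>
    have "(A - C) \<union> (A \<inter> C) = A" by auto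
    then have "A - C \<in> \<xi>"
      using \<xi> A(1) n CB Diff_closed Int_closed unfolding prime_filter_def by metis
    then have "rel_range G lab (A - C) [a] \<in> \<eta>" using \<eta>(2) by auto
    then have "rel_range G lab (A - C) [a] \<inter> rel_range G lab C [a] \<in> \<eta>"
      using \<eta>(1) CB by (auto simp: prime_filter_def)
    then have "rel_range G lab ((A - C) \<inter> C) [a] \<in> \<eta>"
      using rel_range_Int[of "A - C" C] CB Diff_closed by simp
    then show False using \<eta>(1) by (simp add: prime_filter_def Diff_disjoint Int_commute)
  qed
  then have "\<xi> = pullback a \<eta>" using \<eta>(2) sub by (auto simp: pullback_def)
  then show thesis using that alph \<eta>(1) r by blast
qed

text \<open>A boundary path is a sequence of prime families joined by letters, each family being the pullback of the
next one; it may stop, by the label \<open>None\<close>, only at a family without regular sets. Whatever follows the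
first \<open>None\<close> is another boundary path and carries no information about the path.\<close>

definition path_step where
  "path_step \<xi> o' \<eta> \<longleftrightarrow> (case o' of
     None \<Rightarrow> \<forall>A\<in>\<xi>. \<not> regular G lab BB A
   | Some a \<Rightarrow> a \<in> alph \<and> word_range G lab [a] \<in> \<eta> \<and> \<xi> = pullback a \<eta>)"

definition boundary_paths where
  "boundary_paths =
    {x. \<forall>n :: nat. prime_filter (fst x n) \<and> path_step (fst x n) (snd x n) (fst x (Suc n))}"

definition path_tail where
  "path_tail x = ((\<lambda>n. fst x (Suc n)), (\<lambda>n. snd x (Suc n)))"

definition path_Cons where
  "path_Cons a x = (case_nat (pullback a (fst x 0)) (fst x), case_nat (Some a) (snd x))"

text \<open>By dependent choice: a family with a regular set is continued by a lift, any other one ends the path.\<close>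

lemma boundary_path_exists:
  assumes "prime_filter \<xi>\<^sub>0"
  obtains x where "x \<in> boundary_paths" "fst x 0 = \<xi>\<^sub>0"
proof -
  have "\<exists>\<xi>. \<forall>n. (prime_filter (\<xi> n) \<and> (n = 0 \<longrightarrow> \<xi> n = \<xi>\<^sub>0)) \<and> (\<exists>o'. path_step (\<xi> n) o' (\<xi> (Suc n)))"
  proof (rule dependent_nat_choice)
    fix \<xi> and n :: nat assume \<xi>: "prime_filter \<xi> \<and> (n = 0 \<longrightarrow> \<xi> = \<xi>\<^sub>0)"
    show "\<exists>\<eta>. (prime_filter \<eta> \<and> (Suc n = 0 \<longrightarrow> \<eta> = \<xi>\<^sub>0)) \<and> (\<exists>o'. path_step \<xi> o' \<eta>)"
    proof (cases "\<exists>A\<in>\<xi>. regular G lab BB A")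
      case True
      then obtain a \<eta> where "a \<in> alph" "prime_filter \<eta>" "word_range G lab [a] \<in> \<eta>" "\<xi> = pullback a \<eta>"
        using \<xi> prime_filter_lifts by metis
      then show ?thesis by (intro exI[of _ \<eta>] conjI exI[of _ "Some a"]) (auto simp: path_step_def)
    next
      case False
      then show ?thesis using assms
        by (intro exI[of _ \<xi>\<^sub>0] conjI exI[of _ None]) (auto simp: path_step_def)
    qed
  qed (use assms in auto)
  then obtain \<xi> where \<xi>: "\<And>n. prime_filter (\<xi> n)" "\<xi> 0 = \<xi>\<^sub>0" "\<And>n. \<exists>o'. path_step (\<xi> n) o' (\<xi> (Suc n))"
    by auto
  then obtain l where "\<And>n. path_step (\<xi> n) (l n) (\<xi> (Suc n))" by metis
  then show thesis using \<xi> by (intro that[of "(\<xi>, l)"]) (auto simp: boundary_paths_def)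
qed

text \<open>The representation on functions on boundary paths: \<open>p\<^sub>A\<close> restricts to paths starting in \<open>A\<close>, \<open>s\<^sub>a\<close>
translates to paths whose first letter is \<open>a\<close>, and \<open>s\<^sub>a\<^sup>*\<close> translates back. All values off the
boundary paths are zero, so that the relations hold for all functions.\<close>

primrec gen_op where
  "gen_op (GP A) g = (\<lambda>x. if x \<in> boundary_paths \<and> A \<in> fst x 0 then g x else 0)"
| "gen_op (GS a) g = (\<lambda>x. if x \<in> boundary_paths \<and> snd x 0 = Some a then g (path_tail x) else 0)"
| "gen_op (GSstar a) g = (\<lambda>x. if x \<in> boundary_paths \<and> word_range G lab [a] \<in> fst x 0
     then g (path_Cons a x) else 0)"

lemma path_tail_boundary: "x \<in> boundary_paths \<Longrightarrow> path_tail x \<in> boundary_paths"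
  by (auto simp: boundary_paths_def path_tail_def)

lemma path_Cons_boundary:
  assumes "x \<in> boundary_paths" "a \<in> alph" "word_range G lab [a] \<in> fst x 0"
  shows "path_Cons a x \<in> boundary_paths"
proof -
  have x: "prime_filter (fst x n)" "path_step (fst x n) (snd x n) (fst x (Suc n))" for n
    using assms(1) by (simp_all add: boundary_paths_def)
  have "prime_filter (fst (path_Cons a x) n) \<and>
    path_step (fst (path_Cons a x) n) (snd (path_Cons a x) n) (fst (path_Cons a x) (Suc n))" for n
    using assms(2,3) x by (cases n) (simp_all add: path_Cons_def path_step_def prime_filter_pullback)
  then show ?thesis by (simp add: boundary_paths_def)
qed

lemma path_tail_Cons [simp]: "path_tail (path_Cons a x) = x"
  by (simp add: path_tail_def path_Cons_def)

lemma path_Cons_simps [simp]: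
  "fst (path_Cons a x) 0 = pullback a (fst x 0)" "snd (path_Cons a x) 0 = Some a"
  by (simp_all add: path_Cons_def)

lemma boundary_letter:
  assumes "x \<in> boundary_paths" "snd x 0 = Some a"
  shows "a \<in> alph" "word_range G lab [a] \<in> fst (path_tail x) 0"
    "fst x 0 = pullback a (fst (path_tail x) 0)"
proof -
  have "path_step (fst x 0) (snd x 0) (fst x (Suc 0))" using assms(1) by (simp add: boundary_paths_def)
  with assms(2) show "a \<in> alph" "word_range G lab [a] \<in> fst (path_tail x) 0"
    "fst x 0 = pullback a (fst (path_tail x) 0)"
    by (auto simp: path_step_def path_tail_def)
qed

lemma path_Cons_tail:
  assumes "x \<in> boundary_paths" "snd x 0 = Some a"
  shows "path_Cons a (path_tail x) = x"
proof -
  have "case_nat (fst x 0) (\<lambda>n. fst x (Suc n)) = fst x"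
    "case_nat (snd x 0) (\<lambda>n. snd x (Suc n)) = snd x"
    by (rule ext, simp split: nat.split)+
  then show ?thesis using boundary_letter(3)[OF assms] assms(2)
    by (simp add: path_Cons_def) (simp add: path_tail_def)
qed

lemma boundary_prime: "x \<in> boundary_paths \<Longrightarrow> prime_filter (fst x 0)"
  by (auto simp: boundary_paths_def)

sublocale gen_op: generator_action "gen_op :: _ \<Rightarrow> (_ \<Rightarrow> 'k::field) \<Rightarrow> _"
proof
  fix y :: "('a, 'c) llpa_gen" and c :: 'k and g h :: "(nat \<Rightarrow> 'a set set) \<times> (nat \<Rightarrow> 'c option) \<Rightarrow> 'k"
  show "gen_op y (\<lambda>m. g m + h m) = (\<lambda>m. gen_op y g m + gen_op y h m)"
    by (cases y) (simp_all add: fun_eq_iff)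
  show "gen_op y (\<lambda>m. c * g m) = (\<lambda>m. c * gen_op y g m)"
    by (cases y) (simp_all add: fun_eq_iff)
qed

lemmas act_simps = gen_op.act_diff gen_op.act_add gen_op.act_mult gen_op.act_gen gen_op.act_sum

text \<open>A path starting in a regular set \<open>A\<close> cannot have stopped, and its first letter \<open>a\<close> satisfies
\<open>r(A, a) \<noteq> {}\<close>. Hence \<open>a\<close> occurs in the sum, its term has the value \<open>g x\<close>, and all
other terms vanish.\<close>

lemma labels_sum_act:
  assumes "A \<in> BB_reg G lab BB" "x \<in> boundary_paths"
  shows "(\<Sum>a\<in>labels_from G lab A. gen_op (GS a) (gen_op (GP (rel_range G lab A [a]))
      (gen_op (GSstar a) g)) x) = gen_op (GP A) g x"
proof (cases "A = {}")
  case True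
  then show ?thesis using boundary_prime[OF assms(2)]
    by (simp add: prime_filter_def labels_from_def)
next
  case False
  then have reg: "regular G lab BB A" using assms(1) by (auto simp: BB_reg_def)
  then have fin: "finite (labels_from G lab A)" and A: "A \<in> BB" by (auto simp: regular_def)
  let ?t = "\<lambda>a. gen_op (GS a) (gen_op (GP (rel_range G lab A [a])) (gen_op (GSstar a) g)) x"
  have t: "?t a = (if snd x 0 = Some a \<and> A \<in> fst x 0 then g x else 0)" for a
    using assms(2) A boundary_letter[OF assms(2), of a] path_Cons_tail[OF assms(2), of a]
    by (auto simp: path_tail_boundary pullback_def)
  show ?thesis
  proof (cases "A \<in> fst x 0")
    case True
    have "path_step (fst x 0) (snd x 0) (fst x (Suc 0))" using assms(2) by (simp add: boundary_paths_def)
    then obtain a where a: "snd x 0 = Some a"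
      using True reg by (auto simp: path_step_def split: option.splits)
    have "rel_range G lab A [a] \<in> fst (path_tail x) 0"
      using True boundary_letter(3)[OF assms(2) a] by (simp add: pullback_def)
    then have "rel_range G lab A [a] \<noteq> {}"
      using boundary_prime[OF path_tail_boundary[OF assms(2)]] by (auto simp: prime_filter_def)
    then have "a \<in> labels_from G lab A" by (simp add: labels_from_iff_range)
    then have "(\<Sum>b\<in>labels_from G lab A. ?t b) = ?t a"
      unfolding t using a fin by (intro sum.mono_neutral_cong_right[of _ "{a}", simplified]) auto
    then show ?thesis using t[of a] a True assms(2) by simp
  next
    case False
    then show ?thesis unfolding t by simp
  qed
qed

lemma relations_act:
  assumes "f \<in> llpa_rels G lab alph BB"
  shows "gen_op.act f g = (\<lambda>x. 0)"
proof
  fix x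
  note [simp] = act_simps path_tail_boundary path_Cons_boundary
  show "gen_op.act f g x = 0"
  proof (cases "x \<in> boundary_paths")
    case False
    from assms False show ?thesis unfolding llpa_rels_def by (elim UnE) auto
  next
    case True
    note prime = boundary_prime[OF True]
    have letter: "a \<in> alph" "word_range G lab [a] \<in> fst (path_tail x) 0"
      "fst x 0 = pullback a (fst (path_tail x) 0)" if "snd x 0 = Some a" for a
      using boundary_letter[OF True that] by auto
    from assms show ?thesis unfolding llpa_rels_def
    proof (elim UnE)
      assume "f \<in> {gP (A \<inter> B) - gP A * gP B | A B. A \<in> BB \<and> B \<in> BB}"
      then show ?thesis using prime True by (auto simp: prime_filter_def)
    next
      assume "f \<in> {gP (A \<union> B) - (gP A + gP B - gP (A \<inter> B)) | A B. A \<in> BB \<and> B \<in> BB}"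
      then show ?thesis using prime True by (auto simp: prime_filter_def)
    next
      assume "f \<in> {gP {}}"
      then show ?thesis using prime by (auto simp: prime_filter_def)
    next
      assume "f \<in> {gP A * gS a - gS a * gP (rel_range G lab A [a]) | A a. A \<in> BB \<and> a \<in> alph}"
      then show ?thesis using letter True by (auto simp: pullback_def)
    next
      assume "f \<in> {gT a * gP A - gP (rel_range G lab A [a]) * gT a | A a. A \<in> BB \<and> a \<in> alph}"
      then show ?thesis using True by (auto simp: pullback_def)
    next
      assume "f \<in> {gT a * gS a - gP (word_range G lab [a]) | a. a \<in> alph}"
      then show ?thesis using True by auto
    next
      assume "f \<in> {gT b * gS a | a b. a \<in> alph \<and> b \<in> alph \<and> b \<noteq> a}"
      then show ?thesis using True by auto
    next
      assume "f \<in> {gS a * gT a * gS a - gS a | a. a \<in> alph}"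
      then show ?thesis using True letter by auto
    next
      assume "f \<in> {gT a * gS a * gT a - gT a | a. a \<in> alph}"
      then show ?thesis using True by auto
    next
      assume "f \<in> {gP A - (\<Sum>a\<in>labels_from G lab A. gS a * gP (rel_range G lab A [a]) * gT a)
        | A. A \<in> BB_reg G lab BB}"
      then obtain A where "A \<in> BB_reg G lab BB"
        "f = gP A - (\<Sum>a\<in>labels_from G lab A. gS a * gP (rel_range G lab A [a]) * gT a)" by auto
      then show ?thesis using labels_sum_act[of A x g] True by simp
    qed
  qed
qed

text \<open>A prime family containing \<open>B\<close> is the start of a boundary path, at which \<open>p\<^sub>B\<close> maps the constant function
\<open>1\<close> to the value \<open>1\<close>.\<close>

theorem projection_not_in_rel_ideal:
  assumes "B \<in> BB" "B \<noteq> {}"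
  shows "(gen (GP B) :: _ \<Rightarrow>\<^sub>0 'k::field) \<notin> rel_ideal (llpa_gens alph BB) (llpa_rels G lab alph BB)"
proof
  assume ideal: "(gen (GP B) :: _ \<Rightarrow>\<^sub>0 'k) \<in> rel_ideal (llpa_gens alph BB) (llpa_rels G lab alph BB)"
  obtain \<xi> where \<xi>: "prime_filter \<xi>" "{B} \<subseteq> \<xi>"
    using prime_filter_extends[of "{B}"] assms by auto
  then obtain x where x: "x \<in> boundary_paths" "fst x 0 = \<xi>" using boundary_path_exists by metis
  have "gen_op.act (gP B) (\<lambda>_. 1 :: 'k) x = 0"
    using gen_op.act_rel_ideal[OF ideal relations_act] by metis
  then show False using x \<xi>(2) by (simp add: gen_op.act_gen)
qed

end

section \<open>Families satisfying the relations\<close>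

text \<open>Elements of an arbitrary algebra that satisfy the defining relations. The ring has a unit so that the
empty word can be represented by \<open>1\<close>; products such as \<open>S \<alpha> * p A * T \<beta>\<close> then cover all spanning
elements uniformly.\<close>

locale leavitt_family =
  normal_labelled_space G lab alph BB + vector_space scale
  for G :: "('v, 'e) pre_digraph" and lab :: "'e \<Rightarrow> 'a" and alph :: "'a set" and BB :: "'v set set"
    and scale :: "'k::field \<Rightarrow> 'r::ring_1 \<Rightarrow> 'r" (infixr "*s" 75) +
  fixes p :: "'v set \<Rightarrow> 'r" and s t :: "'a \<Rightarrow> 'r"
  assumes scale_mult_left: "(c *s x) * y = c *s (x * y)"
    and scale_mult_right: "x * (c *s y) = c *s (x * y)"
    and p_mult: "\<lbrakk>A \<in> BB; B \<in> BB\<rbrakk> \<Longrightarrow> p A * p B = p (A \<inter> B)"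
    and p_Un: "\<lbrakk>A \<in> BB; B \<in> BB\<rbrakk> \<Longrightarrow> p (A \<union> B) = p A + p B - p (A \<inter> B)"
    and p_empty: "p {} = 0"
    and p_s: "\<lbrakk>A \<in> BB; a \<in> alph\<rbrakk> \<Longrightarrow> p A * s a = s a * p (rel_range G lab A [a])"
    and t_p: "\<lbrakk>A \<in> BB; a \<in> alph\<rbrakk> \<Longrightarrow> t a * p A = p (rel_range G lab A [a]) * t a"
    and t_s_same: "a \<in> alph \<Longrightarrow> t a * s a = p (word_range G lab [a])"
    and t_s_other: "\<lbrakk>a \<in> alph; b \<in> alph; b \<noteq> a\<rbrakk> \<Longrightarrow> t b * s a = 0"
    and s_t_s: "a \<in> alph \<Longrightarrow> s a * t a * s a = s a"
    and t_s_t: "a \<in> alph \<Longrightarrow> t a * s a * t a = t a"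
    and p_regular: "A \<in> BB_reg G lab BB \<Longrightarrow>
      p A = (\<Sum>a\<in>labels_from G lab A. s a * p (rel_range G lab A [a]) * t a)"
begin

text \<open>The sets \<open>r(A, w)\<close> and \<open>r(w)\<close>.\<close>

abbreviation rr where "rr A w \<equiv> rel_range G lab A w"
abbreviation wr where "wr w \<equiv> rel_range G lab (verts G) w"

definition S where "S w = prod_list (map s w)"
definition T where "T w = prod_list (map t (rev w))"

lemma S_simps [simp]: "S [] = 1" "S (a # w) = s a * S w" "S (u @ v) = S u * S v"
  by (simp_all add: S_def)

lemma T_simps [simp]: "T [] = 1" "T (a # w) = T w * t a" "T (u @ v) = T v * T u"
  by (simp_all add: T_def)

lemma p_S: "A \<in> BB \<Longrightarrow> w \<in> lists alph \<Longrightarrow> p A * S w = S w * p (rr A w)"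
proof (induction w arbitrary: A)
  case (Cons a w)
  have "p A * S (a # w) = s a * (p (rr A [a]) * S w)"
    using Cons.prems by (simp add: p_s flip: mult.assoc)
  also have "\<dots> = S (a # w) * p (rr (rr A [a]) w)"
    using Cons by (simp add: rel_range_in_BB mult.assoc)
  finally show ?case using rel_range_Cons_BB[OF Cons.prems(1), of a w] by simp
qed simp

lemma T_p: "A \<in> BB \<Longrightarrow> w \<in> lists alph \<Longrightarrow> T w * p A = p (rr A w) * T w"
proof (induction w arbitrary: A)
  case (Cons a w)
  have "T (a # w) * p A = (T w * p (rr A [a])) * t a"
    using Cons.prems by (simp add: t_p mult.assoc)
  also have "\<dots> = p (rr (rr A [a]) w) * T (a # w)"
    using Cons by (simp add: rel_range_in_BB mult.assoc)
  finally show ?case using rel_range_Cons_BB[OF Cons.prems(1), of a w] by simp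
qed simp

lemma s_range: "a \<in> alph \<Longrightarrow> s a = s a * p (wr [a])"
  using s_t_s[of a] t_s_same[of a] by (simp add: mult.assoc)

lemma t_range: "a \<in> alph \<Longrightarrow> t a = p (wr [a]) * t a"
  using t_s_t[of a] t_s_same[of a] by simp

lemma S_range:
  assumes "w \<noteq> []" "w \<in> lists alph"
  shows "S w * p (wr w) = S w"
proof -
  obtain a v where w: "w = a # v" using assms(1) by (cases w) auto
  then have av: "a \<in> alph" "v \<in> lists alph" using assms by auto
  have "S w = (s a * p (wr [a])) * S v" using s_range[OF av(1)] w by simp
  also have "\<dots> = S w * p (rr (wr [a]) v)"
    using p_S[of "wr [a]" v] av w word_range_in_BB[of "[a]"] by (simp add: mult.assoc)
  finally show ?thesis using word_range_append[of "[a]" v] w by simp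
qed

lemma S_p: "A \<in> BB \<Longrightarrow> w \<in> lists alph \<Longrightarrow> S w * p A = S w * p (A \<inter> wr w)"
proof (cases "w = []")
  case False
  assume A: "A \<in> BB" "w \<in> lists alph"
  have "S w * p A = S w * (p (wr w) * p A)" using S_range[OF False A(2)] by (simp flip: mult.assoc)
  then show ?thesis using A(1) word_range_in_BB[OF False] p_mult by (simp add: Int_commute)
qed (simp add: BB_subset Int_absorb2)

lemma T_S_p:
  "A \<in> BB \<Longrightarrow> w \<in> lists alph \<Longrightarrow> A \<subseteq> wr w \<Longrightarrow> T w * (S w * p A) = p A"
proof (induction w)
  case (Cons a w)
  have R: "wr [a] \<in> BB" by (simp add: word_range_in_BB)
  have wr: "wr (a # w) = rr (wr [a]) w" using word_range_append[of "[a]" w] by simp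
  have sub: "A \<subseteq> wr w" using Cons.prems(3) word_range_append_subset[of "[a]" w] by auto
  have "T (a # w) * (S (a # w) * p A) = T w * ((t a * s a) * (S w * p A))" by (simp add: mult.assoc)
  also have "\<dots> = T w * (S w * (p (rr (wr [a]) w) * p A))"
    using Cons.prems R p_S[of "wr [a]" w] by (simp add: t_s_same flip: mult.assoc)
  also have "p (rr (wr [a]) w) * p A = p A"
    using Cons.prems R wr by (simp add: p_mult rel_range_in_BB Int_absorb1)
  also have "T w * (S w * p A) = p A" using Cons sub by simp
  finally show ?case .
qed simp

text \<open>This and the next lemma say that \<open>s\<^sub>u\<^sup>* s\<^sub>w\<close> cancels \<open>u\<close> when \<open>u\<close> is a prefix of \<open>w\<close>, and vanishes when \<open>w\<close>
is at least as long as \<open>u\<close> but does not extend it.\<close>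

lemma T_S_append:
  assumes A: "A \<in> BB" and uv: "u \<in> lists alph" "v \<in> lists alph"
  shows "T u * (S (u @ v) * p A) = S v * p (A \<inter> wr (u @ v))"
proof (cases "u = []")
  case True
  then show ?thesis using S_p A uv by simp
next
  case False
  let ?A = "A \<inter> wr (u @ v)"
  have R: "wr u \<in> BB" using False by (rule word_range_in_BB)
  have A': "?A \<in> BB" using A by (rule Int_word_range_in_BB)
  have 1: "p ?A = p (rr (wr u) v) * p ?A"
    using A' R word_range_append[of u v] by (simp add: p_mult rel_range_in_BB Int_absorb1)
  have "S v * p ?A = S v * (p (rr (wr u) v) * p ?A)" using 1 by (rule arg_cong)
  also have "\<dots> = p (wr u) * (S v * p ?A)" using p_S[OF R uv(2)] by (simp flip: mult.assoc)
  finally have 2: "S v * p ?A = p (wr u) * (S v * p ?A)" .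
  then have "T u * (S u * (S v * p ?A)) = (T u * (S u * p (wr u))) * (S v * p ?A)"
    by (simp add: mult.assoc)
  also have "\<dots> = S v * p ?A"
    using T_S_p[OF R uv(1) order_refl] 2 by simp
  finally show ?thesis using S_p[OF A, of "u @ v"] uv by (simp add: mult.assoc)
qed

lemma T_S_incomparable:
  "u \<in> lists alph \<Longrightarrow> v \<in> lists alph \<Longrightarrow> length u \<le> length v \<Longrightarrow> \<nexists>w. v = u @ w \<Longrightarrow>
    T u * S v = 0"
proof (induction u arbitrary: v)
  case (Cons a u)
  obtain b v' where v: "v = b # v'" using Cons.prems(3) by (cases v) auto
  show ?case
  proof (cases "a = b")
    case True
    have R: "wr [b] \<in> BB" by (simp add: word_range_in_BB)
    have "T (a # u) * S v = T u * ((t b * s b) * S v')" using True v by (simp add: mult.assoc)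
    also have "\<dots> = (T u * S v') * p (rr (wr [b]) v')"
      using Cons.prems v p_S[OF R, of v'] by (simp add: t_s_same mult.assoc)
    also have "T u * S v' = 0" using Cons.prems v True by (intro Cons.IH) auto
    finally show ?thesis by simp
  next
    case False
    have "T (a # u) * S v = T u * ((t a * s b) * S v')" using v by (simp add: mult.assoc)
    then show ?thesis using t_s_other[of b a] False Cons.prems v by simp
  qed
qed simp

text \<open>The next lemmas compute the compression \<open>x \<mapsto> p\<^sub>C s\<^sub>\<delta>\<^sup>* x s\<^sub>\<delta> p\<^sub>C\<close>. It turns \<open>p\<^sub>B\<close> into \<open>p\<^sub>C\<close>
if \<open>C \<subseteq> r(B, \<delta>)\<close>, and \<open>s\<^sub>\<gamma> p\<^sub>D\<close> into
\<open>s\<^sub>\<epsilon> p\<^sub>E\<close> for the word \<open>\<epsilon>\<close> of the same length with \<open>\<gamma> @ \<delta> = \<delta> @ \<epsilon>\<close>, if there is one, and into \<open>0\<close>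
otherwise.\<close>

lemma compress_projection:
  assumes "B \<in> BB" "C \<in> BB" "C \<subseteq> rr B \<delta>" "\<delta> \<in> lists alph"
  shows "p C * T \<delta> * p B * S \<delta> * p C = p C"
proof -
  have sub: "C \<subseteq> wr \<delta>" using assms(1,3) rel_range_mono[OF BB_subset] by blast
  have "p C * T \<delta> * p B * S \<delta> * p C = p C * (T \<delta> * (S \<delta> * (p (rr B \<delta>) * p C)))"
    using p_S[OF assms(1,4)] by (metis mult.assoc)
  also have "p (rr B \<delta>) * p C = p C"
    using assms by (simp add: p_mult rel_range_in_BB Int_absorb1)
  also have "T \<delta> * (S \<delta> * p C) = p C" using assms sub by (intro T_S_p)
  finally show ?thesis using assms by (simp add: p_mult)
qed

lemma compress_monomial:
  assumes "D \<in> BB" "C \<in> BB" "\<delta> \<in> lists alph" "\<gamma> \<in> lists alph"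
  shows "p C * T \<delta> * (S \<gamma> * p D) * S \<delta> * p C = p C * (T \<delta> * (S (\<gamma> @ \<delta>) * p (rr D \<delta> \<inter> C)))"
proof -
  have "p C * T \<delta> * (S \<gamma> * p D) * S \<delta> * p C
      = p C * (T \<delta> * (S \<gamma> * ((p D * S \<delta>) * p C)))" by (simp add: mult.assoc)
  also have "(p D * S \<delta>) * p C = S \<delta> * p (rr D \<delta> \<inter> C)"
    using assms by (simp add: p_S p_mult rel_range_in_BB mult.assoc)
  finally show ?thesis by (simp add: mult.assoc)
qed

lemma compress_comparable:
  assumes "D \<in> BB" "C \<in> BB" "\<delta> \<in> lists alph" "\<gamma> \<in> lists alph" and \<epsilon>: "\<gamma> @ \<delta> = \<delta> @ \<epsilon>"
  shows "\<exists>E\<in>BB. E \<subseteq> C \<inter> rr C \<epsilon> \<and> p C * T \<delta> * (S \<gamma> * p D) * S \<delta> * p C = S \<epsilon> * p E"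
proof -
  define F where "F = (rr D \<delta> \<inter> C) \<inter> wr (\<delta> @ \<epsilon>)"
  have "\<epsilon> \<in> lists alph" using assms by (metis append_in_lists_conv)
  moreover have "F \<in> BB" unfolding F_def
    using assms by (intro Int_word_range_in_BB Int_closed rel_range_in_BB)
  moreover have "p C * T \<delta> * (S \<gamma> * p D) * S \<delta> * p C = p C * (S \<epsilon> * p F)"
    unfolding compress_monomial[OF assms(1-4)] \<epsilon> F_def
    using T_S_append[of "rr D \<delta> \<inter> C" \<delta> \<epsilon>] assms \<open>\<epsilon> \<in> lists alph\<close> Int_closed rel_range_in_BB by simp
  ultimately have "p C * T \<delta> * (S \<gamma> * p D) * S \<delta> * p C = S \<epsilon> * p (rr C \<epsilon> \<inter> F)"
    using p_S[OF assms(2), of \<epsilon>] assms(2) by (simp add: p_mult rel_range_in_BB flip: mult.assoc)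
      (simp add: mult.assoc p_mult rel_range_in_BB)
  moreover have "rr C \<epsilon> \<inter> F \<subseteq> C \<inter> rr C \<epsilon>" by (auto simp: F_def)
  moreover have "rr C \<epsilon> \<inter> F \<in> BB" using \<open>F \<in> BB\<close> assms Int_closed rel_range_in_BB by simp
  ultimately show ?thesis by metis
qed

lemma compress_incomparable:
  assumes "D \<in> BB" "C \<in> BB" "\<delta> \<in> lists alph" "\<gamma> \<in> lists alph" "\<nexists>\<epsilon>. \<gamma> @ \<delta> = \<delta> @ \<epsilon>"
  shows "p C * T \<delta> * (S \<gamma> * p D) * S \<delta> * p C = 0"
proof -
  have "T \<delta> * S (\<gamma> @ \<delta>) = 0" using assms by (intro T_S_incomparable) auto
  then show ?thesis
    using compress_monomial[OF assms(1-4)] by (simp del: S_simps flip: mult.assoc)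
qed

end

section \<open>From polynomials in the generators to projections\<close>

context leavitt_family
begin

text \<open>Sums of terms \<open>c s\<^sub>\<gamma> p\<^sub>D\<close> are indexed by lists, because only the number of terms matters below: it
decreases when a term is killed, whether or not words repeat.\<close>

definition poly :: "('k \<times> 'a list \<times> 'v set) list \<Rightarrow> 'r" where
  "poly xs = (\<Sum>(c, \<gamma>, D)\<leftarrow>xs. c *s (S \<gamma> * p D))"

definition poly_terms :: "('k \<times> 'a list \<times> 'v set) set" where
  "poly_terms = {(c, \<gamma>, D). \<gamma> \<in> lists alph \<and> \<gamma> \<noteq> [] \<and> D \<in> BB}"

lemma poly_simps [simp]: "poly [] = 0" "poly ((c, \<gamma>, D) # xs) = c *s (S \<gamma> * p D) + poly xs"
  by (simp_all add: poly_def)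

lemma compress_scale: "x * (c *s y) * z * w = c *s (x * y * z * w)"
  by (simp add: scale_mult_left scale_mult_right)

lemma compress_poly:
  assumes "set xs \<subseteq> poly_terms" "C \<in> BB" "\<delta> \<in> lists alph"
  obtains ys where "set ys \<subseteq> poly_terms" "length ys \<le> length xs"
    "p C * T \<delta> * poly xs * S \<delta> * p C = poly ys"
  using assms(1)
proof (induction xs arbitrary: thesis)
  case Nil
  show ?case by (rule Nil(1)[of "[]"]) auto
next
  case (Cons x xs)
  obtain ys where ys: "set ys \<subseteq> poly_terms" "length ys \<le> length xs"
    "p C * T \<delta> * poly xs * S \<delta> * p C = poly ys"
    using Cons.prems(2) by (auto intro: Cons.IH)
  obtain c \<gamma> D where x: "x = (c, \<gamma>, D)" by (cases x)
  have \<gamma>: "\<gamma> \<in> lists alph" "\<gamma> \<noteq> []" "D \<in> BB" using Cons.prems(2) x by (auto simp: poly_terms_def)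
  have sum: "p C * T \<delta> * poly (x # xs) * S \<delta> * p C
    = c *s (p C * T \<delta> * (S \<gamma> * p D) * S \<delta> * p C) + poly ys"
    unfolding ys(3)[symmetric] x poly_simps
    by (simp add: distrib_left distrib_right compress_scale del: scale_left_distrib)
  show ?case
  proof (cases "\<exists>\<epsilon>. \<gamma> @ \<delta> = \<delta> @ \<epsilon>")
    case True
    then obtain \<epsilon> where \<epsilon>: "\<gamma> @ \<delta> = \<delta> @ \<epsilon>" by auto
    obtain E where "E \<in> BB" "p C * T \<delta> * (S \<gamma> * p D) * S \<delta> * p C = S \<epsilon> * p E"
      using compress_comparable[OF \<gamma>(3) assms(2,3) \<gamma>(1) \<epsilon>] by auto
    moreover have "\<epsilon> \<in> lists alph" using \<gamma>(1) assms(3) \<epsilon> by (metis append_in_lists_conv)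
    moreover have "length \<epsilon> = length \<gamma>" using arg_cong[OF \<epsilon>, of length] by simp
    ultimately show ?thesis using ys \<gamma> sum
      by (intro Cons.prems(1)[of "(c, \<epsilon>, E) # ys"]) (auto simp: poly_terms_def)
  next
    case False
    then have "p C * T \<delta> * (S \<gamma> * p D) * S \<delta> * p C = 0"
      using compress_incomparable[OF \<gamma>(3) assms(2,3) \<gamma>(1)] by auto
    then show ?thesis using ys sum by (intro Cons.prems(1)[of ys]) auto
  qed
qed

end

text \<open>A set that is closed under the multiplications and scalings performed in the reduction, such as the
kernel of a homomorphism.\<close>

locale generator_stable = leavitt_family G lab alph BB scale p s t
  for G :: "('v, 'e) pre_digraph" and lab :: "'e \<Rightarrow> 'a" and alph :: "'a set" and BB :: "'v set set"
    and scale :: "'k::field \<Rightarrow> 'r::ring_1 \<Rightarrow> 'r" (infixr "*s" 75)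
    and p :: "'v set \<Rightarrow> 'r" and s t :: "'a \<Rightarrow> 'r" +
  fixes N :: "'r set"
  assumes N_scale: "x \<in> N \<Longrightarrow> c *s x \<in> N"
    and N_p: "x \<in> N \<Longrightarrow> A \<in> BB \<Longrightarrow> p A * x \<in> N \<and> x * p A \<in> N"
    and N_t: "x \<in> N \<Longrightarrow> a \<in> alph \<Longrightarrow> t a * x \<in> N"
    and N_s: "x \<in> N \<Longrightarrow> a \<in> alph \<Longrightarrow> x * s a \<in> N"
    and exits: "is_cycle G lab BB w C \<Longrightarrow> cycle_has_exit G lab BB w C"
begin

lemma N_T: "x \<in> N \<Longrightarrow> w \<in> lists alph \<Longrightarrow> T w * x \<in> N"
  by (induction w arbitrary: x) (simp_all add: N_t mult.assoc)

lemma N_S: "x \<in> N \<Longrightarrow> w \<in> lists alph \<Longrightarrow> x * S w \<in> N"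
  by (induction w arbitrary: x) (simp_all add: N_s flip: mult.assoc)

text \<open>Choose \<open>\<delta>\<close> and \<open>C\<close> for the word of the first term by \<open>aperiodic_piece\<close> and compress: the first term
disappears, the leading projection becomes \<open>p\<^sub>C\<close> with the same coefficient, and every other term remains
a single term or vanishes. Induction on the number of terms leaves a multiple of a projection.\<close>

lemma projection_of_polynomial:
  assumes "c *s p B + poly xs \<in> N" "c \<noteq> 0" "B \<in> BB" "B \<noteq> {}" "set xs \<subseteq> poly_terms"
  shows "\<exists>C\<in>BB. C \<noteq> {} \<and> p C \<in> N"
  using assms
proof (induction "length xs" arbitrary: B xs rule: less_induct)
  case less
  show ?case
  proof (cases xs)
    case Nil
    then have "p B \<in> N" using N_scale[of "c *s p B" "inverse c"] less.prems(1,2) by simp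
    then show ?thesis using less.prems(3,4) by auto
  next
    case (Cons x ys)
    obtain d \<gamma> D where x: "x = (d, \<gamma>, D)" by (cases x)
    have \<gamma>: "\<gamma> \<in> lists alph" "\<gamma> \<noteq> []" "D \<in> BB" and ys: "set ys \<subseteq> poly_terms"
      using less.prems(5) Cons x by (auto simp: poly_terms_def)
    obtain \<delta> C where \<delta>: "\<delta> \<in> lists alph" and C: "C \<in> BB" "C \<noteq> {}" "C \<subseteq> rr B \<delta>"
      and disjoint: "\<And>\<epsilon>. \<gamma> @ \<delta> = \<delta> @ \<epsilon> \<Longrightarrow> C \<inter> rr C \<epsilon> = {}"
      using aperiodic_piece[OF exits less.prems(3,4) \<gamma>(2,1)] by metis
    have killed: "p C * T \<delta> * (S \<gamma> * p D) * S \<delta> * p C = 0"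
    proof (cases "\<exists>\<epsilon>. \<gamma> @ \<delta> = \<delta> @ \<epsilon>")
      case True
      then obtain \<epsilon> where \<epsilon>: "\<gamma> @ \<delta> = \<delta> @ \<epsilon>" by auto
      from compress_comparable[OF \<gamma>(3) C(1) \<delta> \<gamma>(1) \<epsilon>] disjoint[OF \<epsilon>]
      show ?thesis by (auto simp: p_empty)
    next
      case False
      then show ?thesis using compress_incomparable[OF \<gamma>(3) C(1) \<delta> \<gamma>(1)] by auto
    qed
    obtain zs where zs: "set zs \<subseteq> poly_terms" "length zs \<le> length ys"
      "p C * T \<delta> * poly ys * S \<delta> * p C = poly zs"
      using compress_poly[OF ys C(1) \<delta>] .
    have "p C * T \<delta> * (c *s p B + poly xs) * S \<delta> * p C =
      c *s (p C * T \<delta> * p B * S \<delta> * p C)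
      + (d *s (p C * T \<delta> * (S \<gamma> * p D) * S \<delta> * p C) + p C * T \<delta> * poly ys * S \<delta> * p C)"
      unfolding Cons x poly_simps distrib_left distrib_right compress_scale ..
    also have "\<dots> = c *s p C + poly zs"
      using killed zs(3) compress_projection[OF less.prems(3) C(1,3) \<delta>] by simp
    finally have eq: "p C * (T \<delta> * (c *s p B + poly xs)) * S \<delta> * p C = c *s p C + poly zs"
      by (simp only: mult.assoc)
    have "p C * (T \<delta> * (c *s p B + poly xs)) * S \<delta> * p C \<in> N"
      by (intro conjunct1[OF N_p] conjunct2[OF N_p] N_S N_T less.prems(1) C(1) \<delta>)
    then show ?thesis
      using less.hyps[of zs C] zs Cons less.prems(2) C eq by simp
  qed
qed

text \<open>Left multiplication by \<open>s\<^sub>w\<^sup>*\<close> turns each monomial whose word is different from and not shorter than \<open>w\<close>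
into one with a nonempty word, or into zero.\<close>

lemma poly_of_sum:
  assumes "finite I" "w \<in> lists alph" "B \<in> BB"
    "\<And>i. i \<in> I \<Longrightarrow> f i \<in> lists alph \<and> f i \<noteq> w \<and> length w \<le> length (f i)"
  shows "\<exists>xs. set xs \<subseteq> poly_terms \<and> T w * (\<Sum>i\<in>I. c i *s (S (f i) * p B)) = poly xs"
  using assms(1,4)
proof (induction I rule: finite_induct)
  case empty
  show ?case by (intro exI[of _ "[]"]) simp
next
  case (insert i I)
  then obtain xs where xs: "set xs \<subseteq> poly_terms" "T w * (\<Sum>i\<in>I. c i *s (S (f i) * p B)) = poly xs"
    by auto
  have i: "f i \<in> lists alph" "f i \<noteq> w" "length w \<le> length (f i)" using insert.prems by auto
  have sum: "T w * (\<Sum>i\<in>insert i I. c i *s (S (f i) * p B)) = c i *s (T w * (S (f i) * p B)) + poly xs"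
    using insert.hyps xs(2) by (simp add: distrib_left scale_mult_right)
  show ?case
  proof (cases "\<exists>\<epsilon>. f i = w @ \<epsilon>")
    case True
    then obtain \<epsilon> where \<epsilon>: "f i = w @ \<epsilon>" by auto
    then have "\<epsilon> \<noteq> []" "\<epsilon> \<in> lists alph" using i by auto
    then show ?thesis using sum xs(1) T_S_append[OF assms(3,2), of \<epsilon>] \<epsilon> Int_word_range_in_BB[OF assms(3)]
      by (intro exI[of _ "(c i, \<epsilon>, B \<inter> wr (f i)) # xs"]) (auto simp: poly_terms_def)
  next
    case False
    then have "T w * S (f i) = 0" using assms(2) i by (intro T_S_incomparable) auto
    then show ?thesis using sum xs(1) by (intro exI[of _ xs]) (simp flip: mult.assoc)
  qed
qed

text \<open>Multiply from the left by \<open>s\<^sup>*\<close> of a shortest word that occurs: this word leaves a multiple of \<open>p\<^sub>B\<close>, and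
injectivity of \<open>f\<close> makes all other words nonempty.\<close>

lemma projection_of_real_sum:
  assumes "(\<Sum>i\<in>I. c i *s (S (f i) * p B)) \<in> N" "finite I" "I \<noteq> {}" "B \<in> BB" "B \<noteq> {}"
    "inj_on f I" "\<And>i. i \<in> I \<Longrightarrow> c i \<noteq> 0 \<and> f i \<in> lists alph \<and> B \<subseteq> wr (f i)"
  shows "\<exists>C\<in>BB. C \<noteq> {} \<and> p C \<in> N"
proof -
  obtain i where i: "i \<in> I" "\<And>j. j \<in> I \<Longrightarrow> length (f i) \<le> length (f j)"
    using ex_min_if_finite[of "(\<lambda>i. length (f i)) ` I"] assms(2,3) by (auto simp: not_less)
  have fi: "c i \<noteq> 0" "f i \<in> lists alph" "B \<subseteq> wr (f i)" using assms(7) i(1) by auto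
  have "\<exists>xs. set xs \<subseteq> poly_terms \<and> T (f i) * (\<Sum>j\<in>I - {i}. c j *s (S (f j) * p B)) = poly xs"
    using assms(2,4,6,7) i fi by (intro poly_of_sum) (auto simp: inj_on_def)
  then obtain xs where xs: "set xs \<subseteq> poly_terms"
    "T (f i) * (\<Sum>j\<in>I - {i}. c j *s (S (f j) * p B)) = poly xs" by auto
  have "T (f i) * (\<Sum>j\<in>I. c j *s (S (f j) * p B)) = c i *s p B + poly xs"
    unfolding sum.remove[OF assms(2) i(1)] distrib_left xs(2) scale_mult_right
    using T_S_p[OF assms(4) fi(2,3)] by simp
  then have "c i *s p B + poly xs \<in> N" using N_T[OF assms(1) fi(2)] by simp
  then show ?thesis using fi(1) assms(4,5) xs(1) by (rule projection_of_polynomial)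
qed

end

section \<open>From arbitrary elements to polynomials\<close>

context leavitt_family
begin

text \<open>The bound \<open>n\<close> on the number of adjoint letters on the right is the induction parameter of the reduction;
\<open>span (monomials 0)\<close> consists of the elements without adjoint letters, called real here.\<close>

definition monomials :: "nat \<Rightarrow> 'r set" where
  "monomials n = {S \<alpha> * p A * T \<beta> | \<alpha> A \<beta>.
     \<alpha> \<in> lists alph \<and> A \<in> BB \<and> \<beta> \<in> lists alph \<and> length \<beta> \<le> n}"

lemma monomialI:
  "\<lbrakk>\<alpha> \<in> lists alph; A \<in> BB; \<beta> \<in> lists alph; length \<beta> \<le> n\<rbrakk> \<Longrightarrow> S \<alpha> * p A * T \<beta> \<in> span (monomials n)"
  by (intro span_base) (auto simp: monomials_def)

lemma monomials_0: "monomials 0 = {S \<alpha> * p A | \<alpha> A. \<alpha> \<in> lists alph \<and> A \<in> BB}"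
  by (auto simp: monomials_def intro!: exI[of _ "[]"])

lemma monomials_mono: "m \<le> n \<Longrightarrow> span (monomials m) \<subseteq> span (monomials n)"
proof (intro span_mono subsetI)
  fix x assume mn: "m \<le> n" and "x \<in> monomials m"
  then obtain \<alpha> A \<beta> where "x = S \<alpha> * p A * T \<beta>" "\<alpha> \<in> lists alph" "A \<in> BB" "\<beta> \<in> lists alph"
    "length \<beta> \<le> m" unfolding monomials_def by blast
  moreover from this mn have "length \<beta> \<le> n" by simp
  ultimately show "x \<in> monomials n" unfolding monomials_def by blast
qed

lemma span_times_s:
  assumes "x \<in> span (monomials (Suc n))" "a \<in> alph"
  shows "x * s a \<in> span (monomials n)"
  using assms(1)
proof (induction rule: span_induct_alt)
  case base
  show ?case by (simp add: span_zero)
next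
  case (step c m y)
  obtain \<alpha> A \<beta> where m: "m = S \<alpha> * p A * T \<beta>" "\<alpha> \<in> lists alph" "A \<in> BB" "\<beta> \<in> lists alph"
    "length \<beta> \<le> Suc n" using step.hyps by (auto simp: monomials_def)
  have "m * s a \<in> span (monomials n)"
  proof (cases \<beta>)
    case Nil
    have "m * s a = S (\<alpha> @ [a]) * p (rr A [a]) * T []"
      using m assms(2) Nil by (simp add: p_s mult.assoc)
    then show ?thesis using m assms(2) by (simp only:) (intro monomialI, auto simp: rel_range_in_BB)
  next
    case (Cons b \<beta>')
    show ?thesis
    proof (cases "b = a")
      case True
      have R: "wr [a] \<in> BB" by (simp add: word_range_in_BB)
      have "m * s a = S \<alpha> * (p A * (T \<beta>' * (t a * s a)))"
        using m Cons True by (simp add: mult.assoc)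
      also have "\<dots> = S \<alpha> * p (A \<inter> rr (wr [a]) \<beta>') * T \<beta>'"
        using m Cons assms(2) R by (simp add: t_s_same T_p p_mult rel_range_in_BB mult.assoc flip: mult.assoc[of "p _" "p _"])
      finally show ?thesis using m Cons R
        by (simp only:) (intro monomialI, auto intro: Int_closed rel_range_in_BB)
    next
      case False
      then have "m * s a = 0" using m Cons assms(2) t_s_other[of a b] by (simp add: mult.assoc)
      then show ?thesis by (simp add: span_zero)
    qed
  qed
  then show ?case using step.IH
    by (simp add: distrib_right scale_mult_left span_add span_scale)
qed

text \<open>The equation \<open>z = (\<Sum>a\<in>F. z * s a * t a)\<close> expresses that every term of \<open>z\<close> ends in \<open>t a\<close> for some
\<open>a \<in> F\<close>, without choosing coefficients. Letters outside \<open>F\<close> contribute nothing because \<open>z * s b = 0\<close>.\<close>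

lemma ghost_tail_extend:
  assumes z: "z = (\<Sum>a\<in>F. z * s a * t a)" and "F \<subseteq> F'" "finite F'" "F' \<subseteq> alph"
  shows "z = (\<Sum>a\<in>F'. z * s a * t a)"
proof -
  have "z * s b = 0" if b: "b \<in> F' - F" for b
  proof -
    have "z * s b = (\<Sum>a\<in>F. z * s a * (t a * s b))"
      by (subst z) (simp add: sum_distrib_right mult.assoc)
    also have "\<dots> = 0" using b assms by (intro sum.neutral ballI) (subst t_s_other, auto)
    finally show ?thesis .
  qed
  then have "(\<Sum>a\<in>F. z * s a * t a) = (\<Sum>a\<in>F'. z * s a * t a)"
    using assms by (intro sum.mono_neutral_left) auto
  then show ?thesis using z by simp
qed

text \<open>A monomial that ends in \<open>t b\<close> satisfies the equation for \<open>F = {b}\<close> by \<open>t b * s b * t b = t b\<close>, and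
equations add up once their index sets are enlarged to a common one.\<close>

lemma ghost_tail_decomposition:
  assumes "x \<in> span (monomials n)"
  shows "\<exists>y z F. x = y + z \<and> y \<in> span (monomials 0) \<and> finite F \<and> F \<subseteq> alph
    \<and> z = (\<Sum>a\<in>F. z * s a * t a)"
  using assms
proof (induction rule: span_induct_alt)
  case base
  show ?case by (intro exI[of _ 0] exI[of _ "{}"]) (simp add: span_zero)
next
  case (step c m x)
  obtain y z F where x: "x = y + z" "y \<in> span (monomials 0)" "finite F" "F \<subseteq> alph"
    "z = (\<Sum>a\<in>F. z * s a * t a)" using step.IH by blast
  obtain \<alpha> A \<beta> where m: "m = S \<alpha> * p A * T \<beta>" "\<alpha> \<in> lists alph" "A \<in> BB" "\<beta> \<in> lists alph"
    using step.hyps by (auto simp: monomials_def)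
  show ?case
  proof (cases \<beta>)
    case Nil
    then have "m \<in> span (monomials 0)" using m monomialI[of \<alpha> A "[]" 0] by simp
    then have "c *s m + y \<in> span (monomials 0)" using x(2) by (simp add: span_add span_scale)
    then show ?thesis using x by (intro exI[of _ "c *s m + y"] exI[of _ z] exI[of _ F]) simp
  next
    case (Cons b \<beta>')
    have b: "b \<in> alph" using m(4) Cons by simp
    let ?z = "c *s m + z" and ?F = "insert b F"
    have F: "finite ?F" "?F \<subseteq> alph" using x b by auto
    have "m = m * s b * t b" using m(1) Cons t_s_t[OF b] by (simp add: mult.assoc)
    then have "m = (\<Sum>a\<in>{b}. m * s a * t a)" by simp
    from ghost_tail_extend[OF this _ F] have m': "m = (\<Sum>a\<in>?F. m * s a * t a)" by simp
    from ghost_tail_extend[OF x(5) _ F] have z': "z = (\<Sum>a\<in>?F. z * s a * t a)" by auto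
    have "(\<Sum>a\<in>?F. ?z * s a * t a) = c *s (\<Sum>a\<in>?F. m * s a * t a) + (\<Sum>a\<in>?F. z * s a * t a)"
      by (simp only: distrib_right scale_mult_left scale_sum_right sum.distrib)
    then have "?z = (\<Sum>a\<in>?F. ?z * s a * t a)" using m' z' by simp
    then show ?thesis using x F by (intro exI[of _ y] exI[of _ ?z] exI[of _ ?F]) simp
  qed
qed

lemma Union_in_BB: "finite \<A> \<Longrightarrow> \<A> \<subseteq> BB \<Longrightarrow> \<Union>\<A> \<in> BB"
  by (induction \<A> rule: finite_induct) (auto simp: empty_in_BB Un_closed)

lemma unit_enlarge:
  assumes "y * p A = y" "A \<in> BB" "B \<in> BB" "A \<subseteq> B"
  shows "y * p B = y"
proof -
  have "y * p B = y * (p A * p B)" using assms(1) by (simp flip: mult.assoc)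
  then show ?thesis using assms by (simp add: p_mult Int_absorb2)
qed

text \<open>Instead of refining the finitely many sets that occur in a real element into disjoint atoms, restrict to
any \<open>C\<close> that each of them contains or misses. After that, all terms share the projection \<open>p\<^sub>C\<close>.\<close>

lemma real_part_local:
  assumes "y \<in> span (monomials 0)"
  shows "\<exists>\<A>. finite \<A> \<and> \<A> \<subseteq> BB \<and> y * p (\<Union>\<A>) = y \<and>
    (\<forall>C\<in>BB. (\<forall>A\<in>\<A>. C \<subseteq> A \<or> C \<inter> A = {}) \<longrightarrow>
      y * p C \<in> span {S \<alpha> * p C | \<alpha>. \<alpha> \<in> lists alph \<and> C \<subseteq> wr \<alpha>})"
  using assms
proof (induction rule: span_induct_alt)
  case base
  show ?case by (intro exI[of _ "{}"]) (simp add: span_zero)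
next
  case (step c m y)
  obtain \<A> where \<A>: "finite \<A>" "\<A> \<subseteq> BB" "y * p (\<Union>\<A>) = y"
    and loc: "\<And>C. C \<in> BB \<Longrightarrow> (\<forall>A\<in>\<A>. C \<subseteq> A \<or> C \<inter> A = {}) \<Longrightarrow>
      y * p C \<in> span {S \<alpha> * p C | \<alpha>. \<alpha> \<in> lists alph \<and> C \<subseteq> wr \<alpha>}"
    using step.IH by blast
  obtain \<alpha> A where m: "m = S \<alpha> * p A" "\<alpha> \<in> lists alph" "A \<in> BB"
    using step.hyps by (auto simp: monomials_0)
  define B where "B = A \<inter> wr \<alpha>"
  have B: "B \<in> BB" unfolding B_def using m(3) by (rule Int_word_range_in_BB)
  have mB: "m = S \<alpha> * p B" unfolding B_def using S_p[OF m(3,2)] m(1) by simp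
  have U: "\<Union>(insert B \<A>) \<in> BB" using \<A> B by (intro Union_in_BB) auto
  have "m * p (\<Union>(insert B \<A>)) = m"
  proof (rule unit_enlarge[OF _ B U])
    show "m * p B = m" unfolding mB using B by (simp add: mult.assoc p_mult)
  qed simp
  moreover have "y * p (\<Union>(insert B \<A>)) = y"
    by (rule unit_enlarge[OF \<A>(3) Union_in_BB[OF \<A>(1,2)] U]) simp
  ultimately have unit: "(c *s m + y) * p (\<Union>(insert B \<A>)) = c *s m + y"
    by (simp only: distrib_right scale_mult_left)
  have "(c *s m + y) * p C \<in> span {S \<alpha> * p C | \<alpha>. \<alpha> \<in> lists alph \<and> C \<subseteq> wr \<alpha>}"
    if C: "C \<in> BB" "\<forall>A\<in>insert B \<A>. C \<subseteq> A \<or> C \<inter> A = {}" for C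
  proof -
    have mC: "m * p C = S \<alpha> * p (B \<inter> C)" using B C(1) mB by (simp add: mult.assoc p_mult)
    have "m * p C \<in> span {S \<alpha> * p C | \<alpha>. \<alpha> \<in> lists alph \<and> C \<subseteq> wr \<alpha>}"
    proof (cases "C \<subseteq> B")
      case True
      then have "B \<inter> C = C" "C \<subseteq> wr \<alpha>" by (auto simp: B_def)
      then show ?thesis using mC m(2) by (intro span_base) auto
    next
      case False
      then have "B \<inter> C = {}" using C(2) by auto
      then show ?thesis using mC by (simp add: p_empty span_zero)
    qed
    moreover have "y * p C \<in> span {S \<alpha> * p C | \<alpha>. \<alpha> \<in> lists alph \<and> C \<subseteq> wr \<alpha>}"
      using C by (intro loc) auto
    ultimately show ?thesis by (simp add: distrib_right scale_mult_left span_add span_scale)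
  qed
  then show ?case using \<A>(1,2) B unit by (intro exI[of _ "insert B \<A>"]) simp
qed

text \<open>Cutting \<open>C\<close> by one set \<open>A\<close> at a time, \<open>p\<^sub>C = p\<^bsub>C \<inter> A\<^esub> + p\<^bsub>C - A\<^esub>\<close>, so one of the two halves keeps the product
nonzero.\<close>

lemma nonzero_piece:
  assumes "finite \<A>" "\<A> \<subseteq> BB" "C \<in> BB" "x * p C \<noteq> 0"
  shows "\<exists>D\<in>BB. D \<subseteq> C \<and> x * p D \<noteq> 0 \<and> (\<forall>A\<in>\<A>. D \<subseteq> A \<or> D \<inter> A = {})"
  using assms(1,2)
proof (induction \<A> rule: finite_induct)
  case empty
  show ?case using assms(3,4) by auto
next
  case (insert A \<A>)
  then obtain D where D: "D \<in> BB" "D \<subseteq> C" "x * p D \<noteq> 0" "\<forall>A\<in>\<A>. D \<subseteq> A \<or> D \<inter> A = {}" by auto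
  have A: "A \<in> BB" using insert.prems by simp
  have in_BB: "D \<inter> A \<in> BB" "D - A \<in> BB" using D(1) A by (auto intro: Int_closed Diff_closed)
  have "(D \<inter> A) \<union> (D - A) = D" "(D \<inter> A) \<inter> (D - A) = {}" by auto
  then have "p D = p (D \<inter> A) + p (D - A)" using p_Un[OF in_BB] p_empty by simp
  then have "x * p (D \<inter> A) \<noteq> 0 \<or> x * p (D - A) \<noteq> 0" using D(3) by (auto simp: distrib_left)
  then show ?case
  proof
    assume "x * p (D \<inter> A) \<noteq> 0"
    then show ?case using D in_BB by (intro bexI[of _ "D \<inter> A"]) auto
  next
    assume "x * p (D - A) \<noteq> 0"
    then show ?case using D in_BB by (intro bexI[of _ "D - A"]) auto
  qed
qed

lemma st_p: "a \<in> alph \<Longrightarrow> C \<in> BB \<Longrightarrow> s a * t a * p C = p C * s a * t a"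
  by (simp add: mult.assoc t_p) (simp add: p_s flip: mult.assoc)

lemma p_s_no_label: "B \<in> BB \<Longrightarrow> a \<in> alph \<Longrightarrow> a \<notin> labels_from G lab B \<Longrightarrow> t a * p B = 0"
  by (simp add: t_p labels_from_iff_range p_empty)

text \<open>All elements of the algebra generated by the family lie in this span; the lemmas below show that it
contains the generators and is stable under multiplication by them.\<close>

definition monomial_span where "monomial_span = (\<Union>n. span (monomials n))"

lemma monomial_span_induct [consumes 1, case_names zero step]:
  assumes "x \<in> monomial_span" "P 0"
    and "\<And>c \<alpha> A \<beta> y. \<lbrakk>\<alpha> \<in> lists alph; A \<in> BB; \<beta> \<in> lists alph; P y\<rbrakk> \<Longrightarrow> P (c *s (S \<alpha> * p A * T \<beta>) + y)"
  shows "P x"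
proof -
  obtain n where "x \<in> span (monomials n)" using assms(1) by (auto simp: monomial_span_def)
  then show ?thesis
  proof (induction rule: span_induct_alt)
    case (step c m y)
    then show ?case using assms(3) unfolding monomials_def by blast
  qed (rule assms(2))
qed

lemma monomial_in_span:
  "\<lbrakk>\<alpha> \<in> lists alph; A \<in> BB; \<beta> \<in> lists alph\<rbrakk> \<Longrightarrow> S \<alpha> * p A * T \<beta> \<in> monomial_span"
  unfolding monomial_span_def by (intro UN_I[of "length \<beta>"] monomialI) simp_all

lemma monomial_span_add: "x \<in> monomial_span \<Longrightarrow> y \<in> monomial_span \<Longrightarrow> x + y \<in> monomial_span"
proof -
  assume "x \<in> monomial_span" "y \<in> monomial_span"
  then obtain m n where "x \<in> span (monomials m)" "y \<in> span (monomials n)"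
    by (auto simp: monomial_span_def)
  then have "x + y \<in> span (monomials (max m n))"
    using monomials_mono[of m "max m n"] monomials_mono[of n "max m n"] by (intro span_add) auto
  then show ?thesis by (auto simp: monomial_span_def)
qed

lemma monomial_span_scale: "x \<in> monomial_span \<Longrightarrow> c *s x \<in> monomial_span"
  unfolding monomial_span_def by (auto intro: span_scale)

lemma monomial_span_zero: "0 \<in> monomial_span"
  by (auto simp: monomial_span_def span_zero)

lemma monomial_span_closed:
  assumes "\<And>\<alpha> A \<beta>. \<lbrakk>\<alpha> \<in> lists alph; A \<in> BB; \<beta> \<in> lists alph\<rbrakk> \<Longrightarrow> g * (S \<alpha> * p A * T \<beta>) \<in> monomial_span"
    and "x \<in> monomial_span"
  shows "g * x \<in> monomial_span"
  using assms(2)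
  by (induction rule: monomial_span_induct)
    (simp_all add: distrib_left scale_mult_right monomial_span_zero monomial_span_add
      monomial_span_scale assms(1))

lemma p_times_span: "A \<in> BB \<Longrightarrow> x \<in> monomial_span \<Longrightarrow> p A * x \<in> monomial_span"
proof (rule monomial_span_closed)
  fix \<alpha> B \<beta> assume *: "A \<in> BB" "\<alpha> \<in> lists alph" "B \<in> BB" "\<beta> \<in> lists alph"
  have "p A * (S \<alpha> * p B * T \<beta>) = S \<alpha> * (p (rr A \<alpha>) * p B) * T \<beta>"
    using p_S[OF *(1,2)] by (simp flip: mult.assoc)
  also have "\<dots> = S \<alpha> * p (rr A \<alpha> \<inter> B) * T \<beta>"
    using * by (simp add: p_mult rel_range_in_BB)
  finally show "p A * (S \<alpha> * p B * T \<beta>) \<in> monomial_span"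
    using * by (simp only:) (intro monomial_in_span Int_closed rel_range_in_BB)
qed

lemma s_times_span: "a \<in> alph \<Longrightarrow> x \<in> monomial_span \<Longrightarrow> s a * x \<in> monomial_span"
proof (rule monomial_span_closed)
  fix \<alpha> B \<beta> assume *: "a \<in> alph" "\<alpha> \<in> lists alph" "B \<in> BB" "\<beta> \<in> lists alph"
  then have "S (a # \<alpha>) * p B * T \<beta> \<in> monomial_span" by (intro monomial_in_span) simp_all
  then show "s a * (S \<alpha> * p B * T \<beta>) \<in> monomial_span" by (simp add: mult.assoc)
qed

lemma t_times_span: "a \<in> alph \<Longrightarrow> x \<in> monomial_span \<Longrightarrow> t a * x \<in> monomial_span"
proof (rule monomial_span_closed)
  fix \<alpha> B \<beta> assume *: "a \<in> alph" "\<alpha> \<in> lists alph" "B \<in> BB" "\<beta> \<in> lists alph"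
  show "t a * (S \<alpha> * p B * T \<beta>) \<in> monomial_span"
  proof (cases \<alpha>)
    case Nil
    have "t a * (S \<alpha> * p B * T \<beta>) = S [] * p (rr B [a]) * T (\<beta> @ [a])"
      using * Nil by (simp add: t_p flip: mult.assoc)
    then show ?thesis using * by (simp only:) (intro monomial_in_span, auto intro: rel_range_in_BB)
  next
    case (Cons b \<alpha>')
    have "t a * (S \<alpha> * p B * T \<beta>) = (t a * s b) * (S \<alpha>' * p B * T \<beta>)"
      using Cons by (simp add: mult.assoc)
    moreover have "S \<alpha>' * p B * T \<beta> \<in> monomial_span" using * Cons by (intro monomial_in_span) auto
    ultimately show ?thesis using * Cons p_times_span[of "wr [a]"] t_s_other[of b a] word_range_in_BB[of "[a]"]
      by (cases "a = b") (simp_all add: t_s_same monomial_span_zero)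
  qed
qed

lemma generators_in_span:
  "A \<in> BB \<Longrightarrow> p A \<in> monomial_span" "a \<in> alph \<Longrightarrow> s a \<in> monomial_span"
  "a \<in> alph \<Longrightarrow> t a \<in> monomial_span"
proof -
  show "p A \<in> monomial_span" if "A \<in> BB" for A
    using monomial_in_span[of "[]" A "[]"] that by simp
  then have R: "p (wr [a]) \<in> monomial_span" for a by (simp add: word_range_in_BB)
  show "s a \<in> monomial_span" if "a \<in> alph"
    using s_times_span[OF that R[of a]] s_range[OF that] by simp
  show "t a \<in> monomial_span" if a: "a \<in> alph"
  proof -
    have "S [] * p (wr [a]) * T [a] \<in> monomial_span"
      using a by (intro monomial_in_span) (simp_all add: word_range_in_BB)
    then show ?thesis using t_range[OF a] by simp
  qed
qed

end

context generator_stable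
begin

text \<open>A nonzero combination of the \<open>s\<^sub>\<alpha> p\<^sub>C\<close> keeps all its terms when it is multiplied by \<open>s\<^sub>\<delta> p\<^sub>D\<close> with
\<open>{} \<noteq> D \<subseteq> r(C, \<delta>)\<close>: the words \<open>\<alpha> @ \<delta>\<close> are distinct and \<open>D\<close> lies in the range of each.\<close>

lemma projection_of_real_element:
  assumes C: "C \<in> BB" and u: "u \<in> span {S \<alpha> * p C | \<alpha>. \<alpha> \<in> lists alph \<and> C \<subseteq> wr \<alpha>}" "u \<noteq> 0"
    and D: "D \<in> BB" "D \<noteq> {}" "D \<subseteq> rr C \<delta>" and \<delta>: "\<delta> \<in> lists alph" and N: "u * S \<delta> * p D \<in> N"
  shows "\<exists>B\<in>BB. B \<noteq> {} \<and> p B \<in> N"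
proof -
  obtain M c where M: "finite M" "M \<subseteq> {S \<alpha> * p C | \<alpha>. \<alpha> \<in> lists alph \<and> C \<subseteq> wr \<alpha>}"
    and sum: "u = (\<Sum>v\<in>M. c v *s v)"
    using u(1) unfolding span_explicit by auto
  define M' where "M' = {v \<in> M. c v \<noteq> 0}"
  have M': "finite M'" "M' \<subseteq> M" "\<And>v. v \<in> M' \<Longrightarrow> c v \<noteq> 0" using M(1) by (auto simp: M'_def)
  have sum': "u = (\<Sum>v\<in>M'. c v *s v)"
    unfolding sum M'_def using M(1) by (intro sum.mono_neutral_right) auto
  have "\<forall>v\<in>M. \<exists>\<alpha>. v = S \<alpha> * p C \<and> \<alpha> \<in> lists alph \<and> C \<subseteq> wr \<alpha>" using M(2) by auto
  \<comment> \<open>A word is attached to each vector of the combination, so that distinct vectors have distinct words.\<close>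
  then obtain word where word: "\<And>v. v \<in> M \<Longrightarrow> v = S (word v) * p C \<and> word v \<in> lists alph \<and> C \<subseteq> wr (word v)"
    by metis
  have v: "v * S \<delta> * p D = S (word v @ \<delta>) * p D" if "v \<in> M'" for v
  proof -
    have "v * S \<delta> * p D = S (word v) * (p C * S \<delta>) * p D"
      using word[of v] that M'(2) by (metis mult.assoc subsetD)
    also have "\<dots> = S (word v @ \<delta>) * (p (rr C \<delta>) * p D)"
      using p_S[OF C \<delta>] by (simp add: mult.assoc)
    finally show ?thesis using C D by (simp add: p_mult rel_range_in_BB Int_absorb1)
  qed
  have "u * S \<delta> * p D = (\<Sum>v\<in>M'. c v *s (S (word v @ \<delta>) * p D))"
    unfolding sum' sum_distrib_right scale_mult_left using v by (intro sum.cong) auto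
  then have in_N: "(\<Sum>v\<in>M'. c v *s (S (word v @ \<delta>) * p D)) \<in> N" using N by simp
  show ?thesis
  proof (rule projection_of_real_sum[OF in_N M'(1) _ D(1,2)])
    show "M' \<noteq> {}" using sum' u(2) by auto
    show "inj_on (\<lambda>v. word v @ \<delta>) M'"
    proof (rule inj_onI)
      fix v w assume "v \<in> M'" "w \<in> M'" "word v @ \<delta> = word w @ \<delta>"
      moreover from this have "v \<in> M" "w \<in> M" using M'(2) by auto
      ultimately show "v = w" using word[of v] word[of w] by simp
    qed
    fix v assume "v \<in> M'"
    then have "c v \<noteq> 0" "word v \<in> lists alph" "C \<subseteq> wr (word v)" using word[of v] M'(2,3) by auto
    moreover have "rr C \<delta> \<subseteq> wr (word v @ \<delta>)"
      unfolding word_range_append using \<open>C \<subseteq> wr (word v)\<close> by (rule rel_range_mono)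
    ultimately show "c v \<noteq> 0 \<and> word v @ \<delta> \<in> lists alph \<and> D \<subseteq> wr (word v @ \<delta>)"
      using D(3) \<delta> by auto
  qed
qed

text \<open>If \<open>x * s a = 0\<close> for all letters, then \<open>x = y - (\<Sum>a\<in>F. y * s a * t a)\<close> with \<open>y\<close> real and \<open>F\<close> finite.
Restrict to a set \<open>C\<close> where \<open>x\<close> does not vanish and where the terms of \<open>y\<close> have a common projection.
On a regular set the sum relation would give \<open>x * p C = 0\<close>, so \<open>C\<close> is not regular and contains a nonempty
\<open>B\<close> with infinitely many labels or none. In the first case a label \<open>a\<close> outside \<open>F\<close> makes
\<open>x * p B * s a\<close> equal to \<open>y * p B * s a\<close>; in the second case \<open>x * p B = y * p B\<close>. In both cases a real
element of the required form lies in \<open>N\<close>.\<close>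

lemma projection_when_no_continuation:
  assumes x: "x \<in> N" "x \<noteq> 0" "x = y + z" "y \<in> span (monomials 0)"
    and F: "finite F" "F \<subseteq> alph" "z = (\<Sum>a\<in>F. z * s a * t a)"
    and stop: "\<And>a. a \<in> alph \<Longrightarrow> x * s a = 0"
  shows "\<exists>B\<in>BB. B \<noteq> {} \<and> p B \<in> N"
proof -
  have zy: "z * s a = - (y * s a)" if "a \<in> alph" for a
    using stop[OF that] x(3) by (simp add: distrib_right eq_neg_iff_add_eq_0 add.commute)
  have x_y: "x = y - (\<Sum>a\<in>F. y * s a * t a)"
  proof -
    have "z = (\<Sum>a\<in>F. - (y * s a * t a))"
      by (subst F(3)) (use F(2) zy in \<open>intro sum.cong refl; auto\<close>)
    then show ?thesis using x(3) by (simp add: sum_negf)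
  qed
  have x_p: "x * p C = y * p C - (\<Sum>a\<in>F. y * p C * s a * t a)" if "C \<in> BB" for C
  proof -
    have "x * p C = y * p C - (\<Sum>a\<in>F. y * (s a * t a * p C))"
      by (subst x_y) (simp add: left_diff_distrib sum_distrib_right mult.assoc)
    also have "(\<Sum>a\<in>F. y * (s a * t a * p C)) = (\<Sum>a\<in>F. y * p C * s a * t a)"
      using F(2) that by (intro sum.cong refl) (subst st_p, auto simp: mult.assoc)
    finally show ?thesis .
  qed
  obtain \<A> where \<A>: "finite \<A>" "\<A> \<subseteq> BB" "y * p (\<Union>\<A>) = y"
    and loc: "\<And>C. C \<in> BB \<Longrightarrow> (\<forall>A\<in>\<A>. C \<subseteq> A \<or> C \<inter> A = {}) \<Longrightarrow>
      y * p C \<in> span {S \<alpha> * p C | \<alpha>. \<alpha> \<in> lists alph \<and> C \<subseteq> wr \<alpha>}"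
    using real_part_local[OF x(4)] by blast
  have U: "\<Union>\<A> \<in> BB" using \<A>(1,2) by (rule Union_in_BB)
  have "x * p (\<Union>\<A>) = x" unfolding x_p[OF U] \<A>(3) using x_y by simp
  then have "x * p (\<Union>\<A>) \<noteq> 0" using x(2) by simp
  from nonzero_piece[OF \<A>(1,2) U this] obtain C where
    C: "C \<in> BB" "x * p C \<noteq> 0" "\<forall>A\<in>\<A>. C \<subseteq> A \<or> C \<inter> A = {}" by auto
  define u where "u = y * p C"
  have u: "u \<in> span {S \<alpha> * p C | \<alpha>. \<alpha> \<in> lists alph \<and> C \<subseteq> wr \<alpha>}"
    unfolding u_def using loc C by simp
  have "u \<noteq> 0" using C(2) x_p[OF C(1)] unfolding u_def by auto
  have "C \<noteq> {}" using C(2) p_empty by auto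
  have "\<not> regular G lab BB C"
  proof
    assume "regular G lab BB C"
    then have "p C = (\<Sum>a\<in>labels_from G lab C. s a * p (rr C [a]) * t a)"
      by (intro p_regular) (simp add: BB_reg_def)
    then have "x * p C = (\<Sum>a\<in>labels_from G lab C. x * s a * (p (rr C [a]) * t a))"
      by (simp add: sum_distrib_left mult.assoc)
    also have "\<dots> = 0" using stop subsetD[OF labels_from_subset[of C]] by (intro sum.neutral) simp
    finally show False using C(2) by simp
  qed
  from nonregular_piece[OF C(1) \<open>C \<noteq> {}\<close> this] obtain B where
    B: "B \<in> BB" "B \<noteq> {}" "B \<subseteq> C" "infinite (labels_from G lab B) \<or> labels_from G lab B = {}" .
  have yB: "y * p B = u * p B" using B C(1) by (simp add: u_def mult.assoc p_mult Int_absorb1)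
  from B(4) show ?thesis
  proof
    assume "infinite (labels_from G lab B)"
    then have "\<not> labels_from G lab B \<subseteq> F" using F(1) finite_subset by auto
    then obtain a where a: "a \<in> labels_from G lab B" "a \<notin> F" by auto
    have alph: "a \<in> alph" using labels_from_subset a(1) by (rule subsetD)
    have "x * p B * s a = u * p B * s a - (\<Sum>b\<in>F. u * p B * s b * (t b * s a))"
      unfolding x_p[OF B(1)] yB by (simp add: left_diff_distrib sum_distrib_right mult.assoc)
    also have "(\<Sum>b\<in>F. u * p B * s b * (t b * s a)) = 0"
      using F(2) a(2) alph by (intro sum.neutral ballI) (subst t_s_other, auto)
    finally have "x * p B * s a = u * S [a] * p (rr B [a])"
      using B(1) alph by (simp add: p_s mult.assoc)
    moreover have "x * p B * s a \<in> N" using x(1) B(1) alph N_p N_s by simp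
    moreover have "rr B [a] \<noteq> {}" using a(1) by (simp add: labels_from_iff_range)
    moreover have "rr B [a] \<subseteq> rr C [a]" using B(3) by (rule rel_range_mono)
    ultimately show ?thesis using alph B(1)
      by (intro projection_of_real_element[OF C(1) u \<open>u \<noteq> 0\<close>, of "rr B [a]" "[a]"])
        (auto simp: rel_range_in_BB)
  next
    assume none: "labels_from G lab B = {}"
    have "x * p B = y * p B - (\<Sum>b\<in>F. y * s b * (t b * p B))"
      by (subst x_y) (simp add: left_diff_distrib sum_distrib_right mult.assoc)
    also have "(\<Sum>b\<in>F. y * s b * (t b * p B)) = 0"
      using F(2) B(1) none by (intro sum.neutral ballI) (subst p_s_no_label, auto)
    finally have "u * S [] * p B \<in> N" using N_p[OF x(1) B(1)] yB by simp
    then show ?thesis using B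
      by (intro projection_of_real_element[OF C(1) u \<open>u \<noteq> 0\<close> B(1,2), of "[]"]) auto
  qed
qed

lemma projection_of_real:
  assumes x: "x \<in> N" "x \<noteq> 0" "x \<in> span (monomials 0)"
  shows "\<exists>B\<in>BB. B \<noteq> {} \<and> p B \<in> N"
proof -
  obtain \<A> where \<A>: "finite \<A>" "\<A> \<subseteq> BB" "x * p (\<Union>\<A>) = x"
    and loc: "\<And>C. C \<in> BB \<Longrightarrow> (\<forall>A\<in>\<A>. C \<subseteq> A \<or> C \<inter> A = {}) \<Longrightarrow>
      x * p C \<in> span {S \<alpha> * p C | \<alpha>. \<alpha> \<in> lists alph \<and> C \<subseteq> wr \<alpha>}"
    using real_part_local[OF x(3)] by blast
  have "x * p (\<Union>\<A>) \<noteq> 0" using x(2) \<A>(3) by simp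
  from nonzero_piece[OF \<A>(1,2) Union_in_BB[OF \<A>(1,2)] this] obtain C where
    C: "C \<in> BB" "x * p C \<noteq> 0" "\<forall>A\<in>\<A>. C \<subseteq> A \<or> C \<inter> A = {}" by auto
  have "C \<noteq> {}" using C(2) p_empty by auto
  moreover have "x * p C * S [] * p C \<in> N" using x(1) C(1) N_p by simp
  ultimately show ?thesis using C
    by (intro projection_of_real_element[OF C(1) loc C(2), of C "[]"]) auto
qed

text \<open>Multiplying by \<open>s a\<close> on the right removes an adjoint letter. If some such product is nonzero, induction
applies to it; otherwise the previous analysis applies to \<open>x\<close> itself.\<close>

theorem nonzero_ideal_contains_projection:
  assumes "x \<in> N" "x \<noteq> 0" "x \<in> span (monomials n)"
  shows "\<exists>B\<in>BB. B \<noteq> {} \<and> p B \<in> N"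
  using assms
proof (induction n arbitrary: x)
  case 0
  then show ?case by (rule projection_of_real)
next
  case (Suc n)
  show ?case
  proof (cases "\<exists>a\<in>alph. x * s a \<noteq> 0")
    case True
    then obtain a where a: "a \<in> alph" "x * s a \<noteq> 0" by auto
    show ?thesis
      by (rule Suc.IH[OF N_s[OF Suc.prems(1) a(1)] a(2) span_times_s[OF Suc.prems(3) a(1)]])
  next
    case False
    obtain y z F where "x = y + z" "y \<in> span (monomials 0)" "finite F" "F \<subseteq> alph"
      "z = (\<Sum>a\<in>F. z * s a * t a)"
      using ghost_tail_decomposition[OF Suc.prems(3)] by blast
    then show ?thesis using False Suc.prems(1,2) by (intro projection_when_no_continuation) auto
  qed
qed

end

section \<open>A ring type containing all quotients of a ring\<close>

definition two_sided_ideal :: "'r::ring_1 set \<Rightarrow> bool" where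
  "two_sided_ideal J \<longleftrightarrow> 0 \<in> J \<and> (\<forall>x\<in>J. \<forall>y\<in>J. x - y \<in> J) \<and> (\<forall>x\<in>J. \<forall>r. r * x \<in> J \<and> x * r \<in> J)"

lemma two_sided_idealD:
  assumes "two_sided_ideal J"
  shows "0 \<in> J" "x \<in> J \<Longrightarrow> y \<in> J \<Longrightarrow> x - y \<in> J" "x \<in> J \<Longrightarrow> y \<in> J \<Longrightarrow> x + y \<in> J"
    "x \<in> J \<Longrightarrow> - x \<in> J" "x \<in> J \<Longrightarrow> r * x \<in> J" "x \<in> J \<Longrightarrow> x * r \<in> J"
proof -
  show 0: "0 \<in> J" and diff: "\<And>x y. x \<in> J \<Longrightarrow> y \<in> J \<Longrightarrow> x - y \<in> J"
    and "x \<in> J \<Longrightarrow> r * x \<in> J" "x \<in> J \<Longrightarrow> x * r \<in> J"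
    using assms by (auto simp: two_sided_ideal_def)
  show minus: "- x \<in> J" if "x \<in> J" for x using diff[OF 0 that] by simp
  show "x + y \<in> J" if "x \<in> J" "y \<in> J" using diff[OF that(1) minus[OF that(2)]] by simp
qed

text \<open>The quotient by an ideal that depends on parameters is not a type, while the product of the quotients by
all two-sided ideals is one. Embedding a single quotient as one factor of this product turns congruences
modulo the ideal into equations in a ring, to which the results above apply.\<close>

definition quotients_eq :: "('r::ring_1 set \<Rightarrow> 'r) \<Rightarrow> ('r set \<Rightarrow> 'r) \<Rightarrow> bool" where
  "quotients_eq f g \<longleftrightarrow> (\<forall>J. two_sided_ideal J \<longrightarrow> f J - g J \<in> J)"

lemma equivp_quotients_eq: "equivp (quotients_eq :: ('r::ring_1 set \<Rightarrow> 'r) \<Rightarrow> _)"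
proof (rule equivpI)
  show "reflp (quotients_eq :: ('r set \<Rightarrow> 'r) \<Rightarrow> _)"
    by (rule reflpI) (simp add: quotients_eq_def two_sided_idealD)
  show "symp (quotients_eq :: ('r set \<Rightarrow> 'r) \<Rightarrow> _)"
  proof (rule sympI, unfold quotients_eq_def, intro allI impI)
    fix f g :: "'r set \<Rightarrow> 'r" and J :: "'r set"
    assume "\<forall>J. two_sided_ideal J \<longrightarrow> f J - g J \<in> J" "two_sided_ideal J"
    then show "g J - f J \<in> J" using two_sided_idealD(4)[of J "f J - g J"] by simp
  qed
  show "transp (quotients_eq :: ('r set \<Rightarrow> 'r) \<Rightarrow> _)"
  proof (rule transpI, unfold quotients_eq_def, intro allI impI)
    fix f g h :: "'r set \<Rightarrow> 'r" and J :: "'r set"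
    assume "\<forall>J. two_sided_ideal J \<longrightarrow> f J - g J \<in> J" "\<forall>J. two_sided_ideal J \<longrightarrow> g J - h J \<in> J"
      "two_sided_ideal J"
    then show "f J - h J \<in> J" using two_sided_idealD(3)[of J "f J - g J" "g J - h J"] by simp
  qed
qed

quotient_type (overloaded) 'r quotients = "'r::ring_1 set \<Rightarrow> 'r" / quotients_eq
  by (rule equivp_quotients_eq)

instantiation quotients :: (ring_1) ring_1
begin

lift_definition zero_quotients :: "'a quotients" is "\<lambda>_. 0" .
lift_definition one_quotients :: "'a quotients" is "\<lambda>_. 1" .

lift_definition plus_quotients :: "'a quotients \<Rightarrow> 'a quotients \<Rightarrow> 'a quotients"
  is "\<lambda>f g J. f J + g J"
  unfolding quotients_eq_def by (simp add: add_diff_add two_sided_idealD)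

lift_definition uminus_quotients :: "'a quotients \<Rightarrow> 'a quotients" is "\<lambda>f J. - f J"
  unfolding quotients_eq_def using two_sided_idealD(4) by (metis minus_diff_minus)

lift_definition minus_quotients :: "'a quotients \<Rightarrow> 'a quotients \<Rightarrow> 'a quotients"
  is "\<lambda>f g J. f J - g J"
proof (unfold quotients_eq_def, intro allI impI)
  fix f f' g g' :: "'a set \<Rightarrow> 'a" and J :: "'a set"
  assume f: "\<forall>J. two_sided_ideal J \<longrightarrow> f J - f' J \<in> J" and g: "\<forall>J. two_sided_ideal J \<longrightarrow> g J - g' J \<in> J"
    and J: "two_sided_ideal J"
  have "(f J - f' J) - (g J - g' J) \<in> J"
    by (rule two_sided_idealD(2)[OF J f[rule_format, OF J] g[rule_format, OF J]])
  then show "f J - g J - (f' J - g' J) \<in> J" by (simp add: algebra_simps)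
qed

lift_definition times_quotients :: "'a quotients \<Rightarrow> 'a quotients \<Rightarrow> 'a quotients"
  is "\<lambda>f g J. f J * g J"
proof (unfold quotients_eq_def, intro allI impI)
  fix f f' g g' :: "'a set \<Rightarrow> 'a" and J :: "'a set"
  assume f: "\<forall>J. two_sided_ideal J \<longrightarrow> f J - f' J \<in> J" and g: "\<forall>J. two_sided_ideal J \<longrightarrow> g J - g' J \<in> J"
    and J: "two_sided_ideal J"
  have "f J * g J - f' J * g' J = (f J - f' J) * g J + f' J * (g J - g' J)"
    by (simp add: algebra_simps)
  also have "\<dots> \<in> J" using f g J by (intro two_sided_idealD(3,5,6)) auto
  finally show "f J * g J - f' J * g' J \<in> J" .
qed

instance
proof
  show "(0 :: 'a quotients) \<noteq> 1"
  proof (transfer, unfold quotients_eq_def)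
    have "two_sided_ideal {0 :: 'a}" by (simp add: two_sided_ideal_def)
    then show "\<not> (\<forall>J :: 'a set. two_sided_ideal J \<longrightarrow> 0 - 1 \<in> J)" by (auto dest: spec[of _ "{0}"])
  qed
qed (transfer, simp add: quotients_eq_def two_sided_idealD algebra_simps)+

end

lift_definition quotient_const :: "'r::ring_1 \<Rightarrow> 'r quotients" is "\<lambda>r _. r" .

text \<open>The two maps from the ring to the product: \<open>quotient_const\<close> is the diagonal one and supplies central
scalars, \<open>quotient_at J\<close> is supported on the factor of \<open>J\<close>, so that it detects membership in \<open>J\<close>.\<close>

lift_definition quotient_at :: "'r::ring_1 set \<Rightarrow> 'r \<Rightarrow> 'r quotients"
  is "\<lambda>J r J'. if J' = J then r else 0" .

lemma quotient_const_hom: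
  "quotient_const 1 = 1" "quotient_const (x + y) = quotient_const x + quotient_const y"
  "quotient_const (x * y) = quotient_const x * quotient_const y"
  by (transfer, simp add: quotients_eq_def two_sided_idealD)+

lemma quotient_const_central:
  assumes "\<And>y. x * y = y * x"
  shows "quotient_const x * z = z * quotient_const x"
  using assms by transfer (simp add: quotients_eq_def two_sided_idealD)

lemma quotient_const_mult_at: "quotient_const x * quotient_at J y = quotient_at J (x * y)"
  by transfer (simp add: quotients_eq_def two_sided_idealD)

lemma quotient_at_hom:
  "quotient_at J 0 = 0"
  "quotient_at J (x + y) = quotient_at J x + quotient_at J y"
  "quotient_at J (x - y) = quotient_at J x - quotient_at J y"
  "quotient_at J (x * y) = quotient_at J x * quotient_at J y"
  by (transfer, simp add: quotients_eq_def two_sided_idealD)+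

lemma quotient_at_sum: "quotient_at J (\<Sum>i\<in>I. f i) = (\<Sum>i\<in>I. quotient_at J (f i))"
  by (induction I rule: infinite_finite_induct) (simp_all add: quotient_at_hom)

lemma quotient_at_eq_0_iff:
  assumes "two_sided_ideal J"
  shows "quotient_at J x = 0 \<longleftrightarrow> x \<in> J"
  using assms by transfer (auto simp: quotients_eq_def two_sided_idealD)

section \<open>Presented algebras\<close>

lemma free_algebra_closed:
  "0 \<in> free_algebra Sg"
  "f \<in> free_algebra Sg \<Longrightarrow> g \<in> free_algebra Sg \<Longrightarrow> f + g \<in> free_algebra Sg"
  "f \<in> free_algebra Sg \<Longrightarrow> g \<in> free_algebra Sg \<Longrightarrow> f - g \<in> free_algebra Sg"
  "f \<in> free_algebra Sg \<Longrightarrow> g \<in> free_algebra Sg \<Longrightarrow> f * g \<in> free_algebra Sg"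
  "f \<in> free_algebra Sg \<Longrightarrow> Defs.scale c f \<in> free_algebra Sg"
  "y \<in> Sg \<Longrightarrow> gen y \<in> free_algebra Sg"
proof -
  show "0 \<in> free_algebra Sg" by (simp add: free_algebra_def)
  show "f \<in> free_algebra Sg \<Longrightarrow> g \<in> free_algebra Sg \<Longrightarrow> f + g \<in> free_algebra Sg"
    using keys_add[of f g] by (auto simp: free_algebra_def)
  show "f \<in> free_algebra Sg \<Longrightarrow> g \<in> free_algebra Sg \<Longrightarrow> f - g \<in> free_algebra Sg"
  proof -
    have "Poly_Mapping.keys (f - g) \<subseteq> Poly_Mapping.keys f \<union> Poly_Mapping.keys g"
      by (auto simp: in_keys_iff lookup_minus)
    then show "f \<in> free_algebra Sg \<Longrightarrow> g \<in> free_algebra Sg \<Longrightarrow> f - g \<in> free_algebra Sg"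
      by (auto simp: free_algebra_def)
  qed
  show "f \<in> free_algebra Sg \<Longrightarrow> g \<in> free_algebra Sg \<Longrightarrow> f * g \<in> free_algebra Sg"
    using keys_mult[of f g] by (fastforce simp: free_algebra_def plus_fword_def)
  show "f \<in> free_algebra Sg \<Longrightarrow> Defs.scale c f \<in> free_algebra Sg"
    using keys_mult[of "Poly_Mapping.single 0 c" f]
    by (fastforce simp: free_algebra_def Defs.scale_def split: if_splits)
  show "y \<in> Sg \<Longrightarrow> gen y \<in> free_algebra Sg"
    by (simp add: free_algebra_def gen_def)
qed

lemma free_algebra_sum:
  "(\<And>i. i \<in> I \<Longrightarrow> f i \<in> free_algebra Sg) \<Longrightarrow> (\<Sum>i\<in>I. f i) \<in> free_algebra Sg"
  by (induction I rule: infinite_finite_induct) (simp_all add: free_algebra_closed)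

lemma single_0_central:
  "Poly_Mapping.single 0 c * f = f * Poly_Mapping.single (0 :: 'x fword) (c :: 'k::field)"
  by (induction f rule: poly_mapping_additive_induct)
    (simp_all add: mult_single mult.commute distrib_left distrib_right)

lemma rel_ideal_diff: "f \<in> rel_ideal Sg R \<Longrightarrow> g \<in> rel_ideal Sg R \<Longrightarrow> f - g \<in> rel_ideal Sg R"
proof -
  assume f: "f \<in> rel_ideal Sg R" and g: "g \<in> rel_ideal Sg R"
  have "Defs.scale (- 1) g = - g" by (simp add: Defs.scale_def single_uminus)
  then have "- g \<in> rel_ideal Sg R" using rel_ideal.scale[OF g, of "- 1"] by simp
  from rel_ideal.add[OF f this] show ?thesis by simp
qed

text \<open>The projection onto words in the given generators is multiplicative, because a product of words involves
exactly the letters of its factors. Pulling back \<open>rel_ideal Sg R\<close> along it yields an ideal of the whole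
monoid algebra with the same trace on \<open>free_algebra Sg\<close>.\<close>

definition restrict_words :: "'x set \<Rightarrow> ('x fword \<Rightarrow>\<^sub>0 'k::field) \<Rightarrow> 'x fword \<Rightarrow>\<^sub>0 'k" where
  "restrict_words Sg = Poly_Mapping.mapp (\<lambda>w c. if set (letters w) \<subseteq> Sg then c else 0)"

lemma lookup_restrict_words:
  "Poly_Mapping.lookup (restrict_words Sg f) w = (if set (letters w) \<subseteq> Sg then Poly_Mapping.lookup f w else 0)"
  by (auto simp: restrict_words_def lookup_mapp when_def in_keys_iff)

lemma restrict_words_simps:
  "restrict_words Sg 0 = 0"
  "restrict_words Sg (f + g) = restrict_words Sg f + restrict_words Sg g"
  "restrict_words Sg (f - g) = restrict_words Sg f - restrict_words Sg g"
  "restrict_words Sg (Poly_Mapping.single w c) = (if set (letters w) \<subseteq> Sg then Poly_Mapping.single w c else 0)"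
proof -
  show "restrict_words Sg (Poly_Mapping.single w c) = (if set (letters w) \<subseteq> Sg then Poly_Mapping.single w c else 0)"
  proof (rule poly_mapping_eqI)
    fix k
    show "Poly_Mapping.lookup (restrict_words Sg (Poly_Mapping.single w c)) k =
      Poly_Mapping.lookup (if set (letters w) \<subseteq> Sg then Poly_Mapping.single w c else 0) k"
      by (cases "k = w") (simp_all add: lookup_restrict_words lookup_single)
  qed
qed (auto intro!: poly_mapping_eqI simp: lookup_restrict_words lookup_add lookup_minus)

lemma restrict_words_mult: "restrict_words Sg (f * g) = restrict_words Sg f * restrict_words Sg g"
proof (induction f rule: poly_mapping_additive_induct)
  case (single u c)
  show ?case
    by (induction g rule: poly_mapping_additive_induct)
      (auto simp: restrict_words_simps mult_single plus_fword_def distrib_left)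
qed (simp_all add: restrict_words_simps distrib_right)

lemma restrict_words_free: "f \<in> free_algebra Sg \<Longrightarrow> restrict_words Sg f = f"
  by (rule poly_mapping_eqI) (auto simp: lookup_restrict_words free_algebra_def in_keys_iff)

lemma restrict_words_minus_const:
  "restrict_words Sg f - Poly_Mapping.single 0 (Poly_Mapping.lookup f 0) \<in> free_algebra Sg"
  unfolding free_algebra_def
proof (intro CollectI ballI)
  fix w assume w: "w \<in> Poly_Mapping.keys (restrict_words Sg f - Poly_Mapping.single 0 (Poly_Mapping.lookup f 0))"
  then have "w \<noteq> 0" by (auto simp: in_keys_iff lookup_minus lookup_restrict_words zero_fword_def)
  moreover from this have "set (letters w) \<subseteq> Sg"
    using w by (auto simp: in_keys_iff lookup_minus lookup_restrict_words lookup_single split: if_splits)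
  ultimately show "letters w \<noteq> [] \<and> set (letters w) \<subseteq> Sg"
    by (cases w) (simp add: zero_fword_def)
qed

lemma rel_ideal_mult_restrict:
  assumes "f \<in> rel_ideal Sg R"
  shows "restrict_words Sg g * f \<in> rel_ideal Sg R" "f * restrict_words Sg g \<in> rel_ideal Sg R"
proof -
  let ?c = "Poly_Mapping.single 0 (Poly_Mapping.lookup g 0)"
  define h where "h = restrict_words Sg g - ?c"
  have h: "h \<in> free_algebra Sg" unfolding h_def by (rule restrict_words_minus_const)
  have g: "restrict_words Sg g = ?c + h" by (simp add: h_def)
  have c: "?c * f \<in> rel_ideal Sg R"
    using rel_ideal.scale[OF assms] by (simp add: Defs.scale_def)
  show "restrict_words Sg g * f \<in> rel_ideal Sg R"
    unfolding g distrib_right using c rel_ideal.mult_left[OF assms h] by (rule rel_ideal.add)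
  show "f * restrict_words Sg g \<in> rel_ideal Sg R"
    unfolding g distrib_left
    using c rel_ideal.mult_right[OF assms h] by (auto intro: rel_ideal.add simp flip: single_0_central)
qed

definition full_rel_ideal where
  "full_rel_ideal Sg R = {f. restrict_words Sg f \<in> rel_ideal Sg R}"

lemma two_sided_full_rel_ideal: "two_sided_ideal (full_rel_ideal Sg R)"
  unfolding two_sided_ideal_def full_rel_ideal_def
  by (auto simp: restrict_words_simps restrict_words_mult rel_ideal.zero rel_ideal_diff rel_ideal_mult_restrict)

lemma full_rel_ideal_iff: "f \<in> free_algebra Sg \<Longrightarrow> f \<in> full_rel_ideal Sg R \<longleftrightarrow> f \<in> rel_ideal Sg R"
  by (simp add: full_rel_ideal_def restrict_words_free)

context
  fixes Sg :: "'x set" and R :: "('x fword \<Rightarrow>\<^sub>0 'k::field) set"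
begin

abbreviation ideal_class where "ideal_class f \<equiv> ideal_cong Sg R `` {f}"

lemma equiv_ideal_cong: "equiv (free_algebra Sg) (ideal_cong Sg R)"
proof (rule equivI)
  show "ideal_cong Sg R \<subseteq> free_algebra Sg \<times> free_algebra Sg" by (auto simp: ideal_cong_def)
  show "refl_on (free_algebra Sg) (ideal_cong Sg R)"
    by (rule refl_onI) (auto simp: ideal_cong_def rel_ideal.zero)
  show "sym (ideal_cong Sg R)"
    using rel_ideal_diff[OF rel_ideal.zero] by (fastforce simp: ideal_cong_def sym_def)
  show "trans (ideal_cong Sg R)"
    using rel_ideal.add by (fastforce simp: ideal_cong_def trans_def)
qed

lemma ideal_class_eq_iff:
  "f \<in> free_algebra Sg \<Longrightarrow> g \<in> free_algebra Sg \<Longrightarrow> ideal_class f = ideal_class g \<longleftrightarrow> f - g \<in> rel_ideal Sg R"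
  using eq_equiv_class_iff[OF equiv_ideal_cong] by (auto simp: ideal_cong_def)

lemma carrier_presented: "carrier (presented_algebra Sg R) = ideal_class ` free_algebra Sg"
  by (auto simp: presented_algebra_def quotient_def)

lemma presented_add:
  assumes "f \<in> free_algebra Sg" "g \<in> free_algebra Sg"
  shows "ideal_class f \<oplus>\<^bsub>presented_algebra Sg R\<^esub> ideal_class g = ideal_class (f + g)"
proof -
  have "congruent2 (ideal_cong Sg R) (ideal_cong Sg R) (\<lambda>f g. ideal_class (f + g))"
  proof (rule congruent2I[OF equiv_ideal_cong equiv_ideal_cong])
    fix f f' h :: "'x fword \<Rightarrow>\<^sub>0 'k" assume "(f, f') \<in> ideal_cong Sg R" and h: "h \<in> free_algebra Sg"
    then have f: "f \<in> free_algebra Sg" "f' \<in> free_algebra Sg" "f - f' \<in> rel_ideal Sg R"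
      by (auto simp: ideal_cong_def)
    show "ideal_class (f + h) = ideal_class (f' + h)" "ideal_class (h + f) = ideal_class (h + f')"
      using f h by (simp_all add: free_algebra_closed ideal_class_eq_iff)
  qed
  from UN_equiv_class2[OF equiv_ideal_cong equiv_ideal_cong this assms]
  show ?thesis by (simp add: presented_algebra_def)
qed

lemma presented_mult:
  assumes "f \<in> free_algebra Sg" "g \<in> free_algebra Sg"
  shows "ideal_class f \<otimes>\<^bsub>presented_algebra Sg R\<^esub> ideal_class g = ideal_class (f * g)"
proof -
  have "congruent2 (ideal_cong Sg R) (ideal_cong Sg R) (\<lambda>f g. ideal_class (f * g))"
  proof (rule congruent2I[OF equiv_ideal_cong equiv_ideal_cong])
    fix f f' h :: "'x fword \<Rightarrow>\<^sub>0 'k" assume "(f, f') \<in> ideal_cong Sg R" and h: "h \<in> free_algebra Sg"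
    then have f: "f \<in> free_algebra Sg" "f' \<in> free_algebra Sg" "f - f' \<in> rel_ideal Sg R"
      by (auto simp: ideal_cong_def)
    show "ideal_class (f * h) = ideal_class (f' * h)" "ideal_class (h * f) = ideal_class (h * f')"
      using f h rel_ideal.mult_right[OF f(3) h] rel_ideal.mult_left[OF f(3) h]
      by (simp_all add: free_algebra_closed ideal_class_eq_iff left_diff_distrib right_diff_distrib)
  qed
  from UN_equiv_class2[OF equiv_ideal_cong equiv_ideal_cong this assms]
  show ?thesis by (simp add: presented_algebra_def)
qed

lemma presented_smult:
  assumes "f \<in> free_algebra Sg"
  shows "c \<odot>\<^bsub>presented_algebra Sg R\<^esub> ideal_class f = ideal_class (Defs.scale c f)"
proof -
  have "(\<lambda>f. ideal_class (Defs.scale c f)) respects ideal_cong Sg R"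
  proof (rule congruentI)
    fix f f' assume "(f, f') \<in> ideal_cong Sg R"
    then have f: "f \<in> free_algebra Sg" "f' \<in> free_algebra Sg" "f - f' \<in> rel_ideal Sg R"
      by (auto simp: ideal_cong_def)
    have "Defs.scale c f - Defs.scale c f' = Defs.scale c (f - f')"
      by (simp add: Defs.scale_def right_diff_distrib)
    then show "ideal_class (Defs.scale c f) = ideal_class (Defs.scale c f')"
      using f rel_ideal.scale[OF f(3)] by (simp add: free_algebra_closed ideal_class_eq_iff)
  qed
  from UN_equiv_class[OF equiv_ideal_cong this assms]
  show ?thesis by (simp add: presented_algebra_def)
qed

lemma presented_hom_simps:
  assumes "\<phi> \<in> algebra_hom (presented_algebra Sg R) A" "f \<in> free_algebra Sg"
  shows "\<phi> (ideal_class f) \<in> carrier A" "\<phi> (ideal_class (Defs.scale c f)) = c \<odot>\<^bsub>A\<^esub> \<phi> (ideal_class f)"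
    "g \<in> free_algebra Sg \<Longrightarrow> \<phi> (ideal_class (f + g)) = \<phi> (ideal_class f) \<oplus>\<^bsub>A\<^esub> \<phi> (ideal_class g)"
    "g \<in> free_algebra Sg \<Longrightarrow> \<phi> (ideal_class (f * g)) = \<phi> (ideal_class f) \<otimes>\<^bsub>A\<^esub> \<phi> (ideal_class g)"
  using assms
  by (auto simp: algebra_hom_def carrier_presented simp flip: presented_add presented_mult presented_smult)

end

lemma (in assoc_algebra) smult_0_left: "x \<in> carrier A \<Longrightarrow> (0 :: 'k) \<odot>\<^bsub>A\<^esub> x = \<zero>\<^bsub>A\<^esub>"
  using smult_l_null[of x] by (simp add: ring_of_type_algebra_def)

lemma (in assoc_algebra) smult_0_right: "(c :: 'k) \<odot>\<^bsub>A\<^esub> \<zero>\<^bsub>A\<^esub> = \<zero>\<^bsub>A\<^esub>"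
  using smult_r_null[of c] by (simp add: ring_of_type_algebra_def)

lemma (in assoc_algebra) mult_zero:
  assumes "x \<in> carrier A"
  shows "x \<otimes>\<^bsub>A\<^esub> \<zero>\<^bsub>A\<^esub> = \<zero>\<^bsub>A\<^esub>" "\<zero>\<^bsub>A\<^esub> \<otimes>\<^bsub>A\<^esub> x = \<zero>\<^bsub>A\<^esub>"
  using smult_mult_right[of x "\<zero>\<^bsub>A\<^esub>" 0] smult_mult_left[of "\<zero>\<^bsub>A\<^esub>" x 0] assms
    smult_0_left[of "\<zero>\<^bsub>A\<^esub>"] smult_0_left[of "x \<otimes>\<^bsub>A\<^esub> \<zero>\<^bsub>A\<^esub>"] smult_0_left[of "\<zero>\<^bsub>A\<^esub> \<otimes>\<^bsub>A\<^esub> x"]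
    mult_closed[of x "\<zero>\<^bsub>A\<^esub>"] mult_closed[of "\<zero>\<^bsub>A\<^esub>" x]
  by simp_all

section \<open>The uniqueness theorem\<close>

definition quotient_scale :: "'k::field \<Rightarrow> ('x fword \<Rightarrow>\<^sub>0 'k) quotients \<Rightarrow> ('x fword \<Rightarrow>\<^sub>0 'k) quotients"
  where "quotient_scale c x = quotient_const (Poly_Mapping.single 0 c) * x"

lemma vector_space_quotient_scale:
  "vector_space (quotient_scale :: 'k::field \<Rightarrow> ('x fword \<Rightarrow>\<^sub>0 'k) quotients \<Rightarrow> _)"
proof (unfold_locales, goal_cases)
  case (1 a x y)
  then show ?case by (simp add: quotient_scale_def distrib_left)
next
  case (2 a b x)
  then show ?case by (simp add: quotient_scale_def single_add quotient_const_hom distrib_right)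
next
  case (3 a b x)
  have "Poly_Mapping.single (0 :: 'x fword) (a * b) = Poly_Mapping.single 0 a * Poly_Mapping.single 0 b"
    by (simp add: mult_single)
  then show ?case by (simp add: quotient_scale_def quotient_const_hom mult.assoc)
next
  case (4 x)
  then show ?case by (simp add: quotient_scale_def quotient_const_hom)
qed

lemma quotient_scale_mult:
  "quotient_scale c x * y = quotient_scale c (x * y)"
  "x * quotient_scale c y = quotient_scale c (x * y)"
proof -
  show "quotient_scale c x * y = quotient_scale c (x * y)"
    by (simp add: quotient_scale_def mult.assoc)
  have "quotient_const (Poly_Mapping.single 0 c) * x = x * quotient_const (Poly_Mapping.single 0 c)"
    by (rule quotient_const_central) (rule single_0_central)
  then show "x * quotient_scale c y = quotient_scale c (x * y)"
    by (simp add: quotient_scale_def flip: mult.assoc)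
qed

lemma quotient_scale_at: "quotient_scale c (quotient_at J f) = quotient_at J (Defs.scale c f)"
  by (simp add: quotient_scale_def quotient_const_mult_at Defs.scale_def)

context normal_labelled_space
begin

lemma llpa_gens_free:
  "A \<in> BB \<Longrightarrow> gen (GP A) \<in> free_algebra (llpa_gens alph BB)"
  "a \<in> alph \<Longrightarrow> gen (GS a) \<in> free_algebra (llpa_gens alph BB)"
  "a \<in> alph \<Longrightarrow> gen (GSstar a) \<in> free_algebra (llpa_gens alph BB)"
  by (auto intro!: free_algebra_closed(6) simp: llpa_gens_def)

lemma llpa_rels_free: "llpa_rels G lab alph BB \<subseteq> free_algebra (llpa_gens alph BB)"
proof -
  note closed = free_algebra_closed(1-4) free_algebra_sum llpa_gens_free empty_in_BB
    Int_closed Un_closed rel_range_in_BB word_range_in_BB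
  have labels: "a \<in> labels_from G lab A \<Longrightarrow> a \<in> alph" for a A
    using labels_from_subset[of A] by auto
  have reg: "A \<in> BB_reg G lab BB \<Longrightarrow> A \<in> BB" for A
    by (auto simp: BB_reg_def regular_def empty_in_BB)
  show ?thesis
    unfolding llpa_rels_def
    by (intro Un_least; clarify?; simp?; (intro closed)?; (simp add: labels reg)?)
qed

text \<open>The quotient map by the ideal of relations, into the corresponding factor of the product of quotients.\<close>

definition llpa_quot where
  "llpa_quot = quotient_at (full_rel_ideal (llpa_gens alph BB) (llpa_rels G lab alph BB))"

lemma llpa_quot_eq_0_iff:
  "f \<in> free_algebra (llpa_gens alph BB) \<Longrightarrow>
    llpa_quot f = 0 \<longleftrightarrow> f \<in> rel_ideal (llpa_gens alph BB) (llpa_rels G lab alph BB)"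
  by (simp add: llpa_quot_def quotient_at_eq_0_iff two_sided_full_rel_ideal full_rel_ideal_iff)

lemma llpa_quot_rel: "f \<in> llpa_rels G lab alph BB \<Longrightarrow> llpa_quot f = 0"
  using llpa_rels_free by (subst llpa_quot_eq_0_iff) (auto intro: rel_ideal.base)

lemma llpa_quot_hom:
  "llpa_quot 0 = 0" "llpa_quot (f + g) = llpa_quot f + llpa_quot g" "llpa_quot (f - g) = llpa_quot f - llpa_quot g" "llpa_quot (f * g) = llpa_quot f * llpa_quot g"
  "llpa_quot (\<Sum>i\<in>I. h i) = (\<Sum>i\<in>I. llpa_quot (h i))" "llpa_quot (Defs.scale c f) = quotient_scale c (llpa_quot f)"
  by (simp_all add: llpa_quot_def quotient_at_hom quotient_at_sum quotient_scale_at)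

lemma llpa_quot_eqI: "f - g \<in> llpa_rels G lab alph BB \<Longrightarrow> llpa_quot f = llpa_quot g"
  using llpa_quot_rel[of "f - g"] by (simp add: llpa_quot_hom)

lemma leavitt_family_quotient:
  "leavitt_family G lab alph BB (quotient_scale :: 'k::field \<Rightarrow> _)
    (\<lambda>A. llpa_quot (gen (GP A))) (\<lambda>a. llpa_quot (gen (GS a))) (\<lambda>a. llpa_quot (gen (GSstar a)))"
proof -
  interpret vector_space "quotient_scale :: 'k \<Rightarrow> (('a, 'c) llpa_gen fword \<Rightarrow>\<^sub>0 'k) quotients \<Rightarrow> _"
    by (rule vector_space_quotient_scale)
  let ?quot = "llpa_quot :: (('a, 'c) llpa_gen fword \<Rightarrow>\<^sub>0 'k) \<Rightarrow> _"
  show ?thesis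
  proof (unfold_locales, goal_cases)
    case 1 show ?case by (rule quotient_scale_mult)
  next
    case 2 show ?case by (rule quotient_scale_mult)
  next
    case (3 A B)
    then have "?quot (gP (A \<inter> B)) = ?quot (gP A * gP B)"
      by (intro llpa_quot_eqI) (unfold llpa_rels_def, blast)
    then show ?case by (simp add: llpa_quot_hom)
  next
    case (4 A B)
    then have "?quot (gP (A \<union> B)) = ?quot (gP A + gP B - gP (A \<inter> B))"
      by (intro llpa_quot_eqI) (unfold llpa_rels_def, blast)
    then show ?case by (simp add: llpa_quot_hom)
  next
    case 5
    show ?case by (intro llpa_quot_rel) (simp add: llpa_rels_def)
  next
    case (6 A a)
    then have "?quot (gP A * gS a) = ?quot (gS a * gP (rel_range G lab A [a]))"
      by (intro llpa_quot_eqI) (unfold llpa_rels_def, blast)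
    then show ?case by (simp add: llpa_quot_hom)
  next
    case (7 A a)
    then have "?quot (gT a * gP A) = ?quot (gP (rel_range G lab A [a]) * gT a)"
      by (intro llpa_quot_eqI) (unfold llpa_rels_def, blast)
    then show ?case by (simp add: llpa_quot_hom)
  next
    case (8 a)
    then have "?quot (gT a * gS a) = ?quot (gP (word_range G lab [a]))"
      by (intro llpa_quot_eqI) (unfold llpa_rels_def, blast)
    then show ?case by (simp add: llpa_quot_hom)
  next
    case (9 a b)
    then have "?quot (gT b * gS a) = 0"
      by (intro llpa_quot_rel) (unfold llpa_rels_def, blast)
    then show ?case by (simp add: llpa_quot_hom)
  next
    case (10 a)
    then have "?quot (gS a * gT a * gS a) = ?quot (gS a)"
      by (intro llpa_quot_eqI) (unfold llpa_rels_def, blast)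
    then show ?case by (simp add: llpa_quot_hom)
  next
    case (11 a)
    then have "?quot (gT a * gS a * gT a) = ?quot (gT a)"
      by (intro llpa_quot_eqI) (unfold llpa_rels_def, blast)
    then show ?case by (simp add: llpa_quot_hom)
  next
    case (12 A)
    then have "?quot (gP A) = ?quot (\<Sum>a\<in>labels_from G lab A. gS a * gP (rel_range G lab A [a]) * gT a)"
      by (intro llpa_quot_eqI) (unfold llpa_rels_def, blast)
    then show ?case by (simp add: llpa_quot_hom)
  qed
qed

text \<open>Nonempty words in the generators are built by multiplying from the left, under which the span is
stable.\<close>

lemma llpa_quot_in_monomial_span:
  assumes "f \<in> free_algebra (llpa_gens alph BB)"
  shows "llpa_quot f \<in> leavitt_family.monomial_span alph BB (quotient_scale :: 'k::field \<Rightarrow> _)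
    (\<lambda>A. llpa_quot (gen (GP A))) (\<lambda>a. llpa_quot (gen (GS a))) (\<lambda>a. llpa_quot (gen (GSstar a)))"
proof -
  interpret leavitt_family G lab alph BB "quotient_scale :: 'k \<Rightarrow> _"
    "\<lambda>A. llpa_quot (gen (GP A))" "\<lambda>a. llpa_quot (gen (GS a))" "\<lambda>a. llpa_quot (gen (GSstar a))"
    by (rule leavitt_family_quotient)
  have words: "llpa_quot (Poly_Mapping.single (FWord ys) 1) \<in> monomial_span"
    if "ys \<noteq> []" "set ys \<subseteq> llpa_gens alph BB" for ys
    using that
  proof (induction ys rule: list_nonempty_induct)
    case (single y)
    then have "y \<in> llpa_gens alph BB" by simp
    then have "llpa_quot (gen y) \<in> monomial_span" by (auto simp: llpa_gens_def generators_in_span)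
    then show ?case by (simp add: gen_def)
  next
    case (cons y ys)
    have "Poly_Mapping.single (FWord (y # ys)) 1 = gen y * Poly_Mapping.single (FWord ys) (1 :: 'k)"
      by (simp add: gen_def mult_single plus_fword_def)
    moreover have "y \<in> llpa_gens alph BB" "llpa_quot (Poly_Mapping.single (FWord ys) 1) \<in> monomial_span"
      using cons by auto
    ultimately show ?case
      by (auto simp: llpa_quot_hom llpa_gens_def p_times_span s_times_span t_times_span)
  qed
  have single: "llpa_quot (Poly_Mapping.single w c) \<in> monomial_span" if "w \<in> Poly_Mapping.keys f" for w c
  proof -
    have "llpa_quot (Poly_Mapping.single (FWord (letters w)) 1) \<in> monomial_span"
      using words[of "letters w"] assms that by (simp add: free_algebra_def)
    moreover have "Poly_Mapping.single w c = Defs.scale c (Poly_Mapping.single (FWord (letters w)) 1)"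
      by (simp add: Defs.scale_def mult_single)
    ultimately show ?thesis by (simp add: llpa_quot_hom monomial_span_scale)
  qed
  have "f = (\<Sum>w\<in>Poly_Mapping.keys f. Poly_Mapping.single w (Poly_Mapping.lookup f w))"
    by (rule poly_mapping_eqI) (simp add: lookup_sum lookup_single when_def in_keys_iff)
  then have "llpa_quot f = (\<Sum>w\<in>Poly_Mapping.keys f. llpa_quot (Poly_Mapping.single w (Poly_Mapping.lookup f w)))"
    using llpa_quot_hom(5) by metis
  also have "\<dots> \<in> monomial_span"
  proof -
    have "(\<Sum>w\<in>W. llpa_quot (Poly_Mapping.single w (Poly_Mapping.lookup f w))) \<in> monomial_span"
      if "finite W" "W \<subseteq> Poly_Mapping.keys f" for W
      using that
      by (induction W rule: finite_induct) (simp_all add: monomial_span_zero monomial_span_add single)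
    then show ?thesis by simp
  qed
  finally show ?thesis .
qed

abbreviation llpa_class where
  "llpa_class f \<equiv> ideal_cong (llpa_gens alph BB) (llpa_rels G lab alph BB) `` {f}"

text \<open>The images of the kernel elements form a stable set. If it contained a nonzero element it would contain
some \<open>p\<^sub>B\<close> with \<open>B\<close> nonempty; then \<open>p\<^sub>B\<close> is congruent to a kernel element, so \<open>\<phi>\<close> vanishes on it.\<close>

theorem kernel_is_rel_ideal:
  fixes A :: "('k::field, 'm) module" and \<phi>
  assumes exits: "\<And>w C. is_cycle G lab BB w C \<Longrightarrow> cycle_has_exit G lab BB w C"
    and A: "assoc_algebra A"
    and \<phi>: "\<phi> \<in> algebra_hom (presented_algebra (llpa_gens alph BB) (llpa_rels G lab alph BB)) A"
    and nonzero: "\<And>B. B \<in> BB \<Longrightarrow> B \<noteq> {} \<Longrightarrow> \<phi> (llpa_class (gen (GP B))) \<noteq> \<zero>\<^bsub>A\<^esub>"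
    and f: "f \<in> free_algebra (llpa_gens alph BB)" "\<phi> (llpa_class f) = \<zero>\<^bsub>A\<^esub>"
  shows "f \<in> rel_ideal (llpa_gens alph BB) (llpa_rels G lab alph BB)"
proof (rule ccontr)
  assume not_ideal: "f \<notin> rel_ideal (llpa_gens alph BB) (llpa_rels G lab alph BB)"
  interpret assoc_algebra A by (rule A)
  let ?F = "free_algebra (llpa_gens alph BB) :: (('a, 'c) llpa_gen fword \<Rightarrow>\<^sub>0 'k) set"
  define N where "N = {llpa_quot g | g. g \<in> ?F \<and> \<phi> (llpa_class g) = \<zero>\<^bsub>A\<^esub>}"
  note hom = presented_hom_simps[OF \<phi>]
  have N_left: "llpa_quot g * x \<in> N" if g: "g \<in> ?F" and x: "x \<in> N" for g x
  proof -
    obtain h where h: "x = llpa_quot h" "h \<in> ?F" "\<phi> (llpa_class h) = \<zero>\<^bsub>A\<^esub>" using x by (auto simp: N_def)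
    have "\<phi> (llpa_class (g * h)) = \<zero>\<^bsub>A\<^esub>" using hom(4)[OF g h(2)] h(3) mult_zero(1)[OF hom(1)[OF g]] by simp
    then show ?thesis
      unfolding N_def h(1) llpa_quot_hom(4)[symmetric] using g h(2) free_algebra_closed(4) by blast
  qed
  have N_right: "x * llpa_quot g \<in> N" if g: "g \<in> ?F" and x: "x \<in> N" for g x
  proof -
    obtain h where h: "x = llpa_quot h" "h \<in> ?F" "\<phi> (llpa_class h) = \<zero>\<^bsub>A\<^esub>" using x by (auto simp: N_def)
    have "\<phi> (llpa_class (h * g)) = \<zero>\<^bsub>A\<^esub>" using hom(4)[OF h(2) g] h(3) mult_zero(2)[OF hom(1)[OF g]] by simp
    then show ?thesis
      unfolding N_def h(1) llpa_quot_hom(4)[symmetric] using g h(2) free_algebra_closed(4) by blast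
  qed
  have N_scale: "quotient_scale c x \<in> N" if x: "x \<in> N" for c x
  proof -
    obtain h where h: "x = llpa_quot h" "h \<in> ?F" "\<phi> (llpa_class h) = \<zero>\<^bsub>A\<^esub>" using x by (auto simp: N_def)
    have "\<phi> (llpa_class (Defs.scale c h)) = \<zero>\<^bsub>A\<^esub>" using hom(2)[OF h(2)] h(3) smult_0_right by simp
    then show ?thesis
      unfolding N_def h(1) llpa_quot_hom(6)[symmetric] using h(2) free_algebra_closed(5) by blast
  qed
  interpret leavitt_family G lab alph BB "quotient_scale :: 'k \<Rightarrow> _"
    "\<lambda>A. llpa_quot (gen (GP A))" "\<lambda>a. llpa_quot (gen (GS a))" "\<lambda>a. llpa_quot (gen (GSstar a))"
    by (rule leavitt_family_quotient)
  interpret generator_stable G lab alph BB "quotient_scale :: 'k \<Rightarrow> _"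
    "\<lambda>A. llpa_quot (gen (GP A))" "\<lambda>a. llpa_quot (gen (GS a))" "\<lambda>a. llpa_quot (gen (GSstar a))" N
    by unfold_locales (auto intro: N_left N_right N_scale llpa_gens_free exits)
  have "llpa_quot f \<in> N" using f by (auto simp: N_def)
  moreover have "llpa_quot f \<noteq> 0" using llpa_quot_eq_0_iff[OF f(1)] not_ideal by simp
  moreover obtain n where "llpa_quot f \<in> span (monomials n)"
    using llpa_quot_in_monomial_span[OF f(1)] by (auto simp: monomial_span_def)
  ultimately obtain B where B: "B \<in> BB" "B \<noteq> {}" "llpa_quot (gen (GP B)) \<in> N"
    using nonzero_ideal_contains_projection by blast
  then obtain g where g: "llpa_quot (gen (GP B)) = llpa_quot g" "g \<in> ?F" "\<phi> (llpa_class g) = \<zero>\<^bsub>A\<^esub>"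
    by (auto simp: N_def)
  have gB: "gen (GP B) \<in> ?F" using B(1) by (rule llpa_gens_free)
  have "gen (GP B) - g \<in> rel_ideal (llpa_gens alph BB) (llpa_rels G lab alph BB)"
    using g gB by (subst llpa_quot_eq_0_iff[symmetric]) (simp_all add: llpa_quot_hom free_algebra_closed)
  then have "llpa_class (gen (GP B)) = llpa_class g"
    using g(2) gB by (subst ideal_class_eq_iff) simp_all
  then show False using nonzero[OF B(1,2)] g(3) by simp
qed

end

theorem theorem4p3:
  fixes G :: "('v, 'e) pre_digraph" and lab :: "'e \<Rightarrow> 'a" and alph :: "'a set"
    and BB :: "'v set set" and A :: "('k::field, 'b) module"
    and \<phi> :: "(('v, 'a) llpa_gen fword \<Rightarrow>\<^sub>0 'k) set \<Rightarrow> 'b"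
  assumes "normal_labelled_space G lab alph BB"
    and "\<And>w C. is_cycle G lab BB w C \<Longrightarrow> cycle_has_exit G lab BB w C"
    and "assoc_algebra A"
    and "\<phi> \<in> algebra_hom (LLPA G lab alph BB) A"
  shows "inj_on \<phi> (carrier (LLPA G lab alph BB :: ('k, _) module)) \<longleftrightarrow>
    (\<forall>B \<in> BB. B \<noteq> {} \<longrightarrow> \<phi> (LLPA_p G lab alph BB B) \<noteq> \<zero>\<^bsub>A\<^esub>)"
proof -
  interpret normal_labelled_space G lab alph BB by (rule assms(1))
  interpret assoc_algebra A by (rule assms(3))
  let ?I = "rel_ideal (llpa_gens alph BB) (llpa_rels G lab alph BB) :: (_ \<Rightarrow>\<^sub>0 'k) set"
  let ?F = "free_algebra (llpa_gens alph BB) :: (_ \<Rightarrow>\<^sub>0 'k) set"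
  have \<phi>: "\<phi> \<in> algebra_hom (presented_algebra (llpa_gens alph BB) (llpa_rels G lab alph BB)) A"
    using assms(4) by (simp add: LLPA_def)
  note hom = presented_hom_simps[OF \<phi>]
  have carrier: "carrier (LLPA G lab alph BB :: ('k, _) module) = llpa_class ` ?F"
    by (simp add: LLPA_def carrier_presented)
  have cancel: "x \<oplus>\<^bsub>A\<^esub> (- 1) \<odot>\<^bsub>A\<^esub> x = \<zero>\<^bsub>A\<^esub>" if "x \<in> carrier A" for x
    using smult_l_distr[of 1 "- 1" x] smult_one[of x] smult_0_left[of x] that
    by (simp add: ring_of_type_algebra_def)
  have \<phi>_diff: "\<phi> (llpa_class (f - g)) = \<phi> (llpa_class f) \<oplus>\<^bsub>A\<^esub> (- 1) \<odot>\<^bsub>A\<^esub> \<phi> (llpa_class g)"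
    if "f \<in> ?F" "g \<in> ?F" for f g
  proof -
    have eq: "f - g = f + Defs.scale (- 1) g" by (simp add: Defs.scale_def single_uminus)
    show ?thesis unfolding eq using that by (simp add: hom free_algebra_closed)
  qed
  have \<phi>_zero: "\<phi> (llpa_class 0) = \<zero>\<^bsub>A\<^esub>"
    using \<phi>_diff[of 0 0] cancel[OF hom(1)] by (simp add: free_algebra_closed)
  show ?thesis
  proof (intro iffI ballI impI notI)
    fix B assume inj: "inj_on \<phi> (carrier (LLPA G lab alph BB :: ('k, _) module))"
      and B: "B \<in> BB" "B \<noteq> {}" "\<phi> (LLPA_p G lab alph BB B) = \<zero>\<^bsub>A\<^esub>"
    have gen: "gen (GP B) \<in> ?F" using B(1) by (rule llpa_gens_free)
    then have "llpa_class (gen (GP B) :: _ \<Rightarrow>\<^sub>0 'k) = llpa_class 0"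
      using B(3) \<phi>_zero by (intro inj_onD[OF inj]) (auto simp: carrier LLPA_p_def free_algebra_closed)
    then have "gen (GP B) \<in> ?I" using gen by (subst (asm) ideal_class_eq_iff) (simp_all add: free_algebra_closed)
    then show False by (rule notE[OF projection_not_in_rel_ideal[OF B(1,2)]])
  next
    assume nonzero: "\<forall>B\<in>BB. B \<noteq> {} \<longrightarrow> \<phi> (LLPA_p G lab alph BB B) \<noteq> \<zero>\<^bsub>A\<^esub>"
    show "inj_on \<phi> (carrier (LLPA G lab alph BB :: ('k, _) module))"
      unfolding carrier
    proof (rule inj_onI, clarify)
      fix f g assume fg: "f \<in> ?F" "g \<in> ?F" "\<phi> (llpa_class f) = \<phi> (llpa_class g)"
      have "\<phi> (llpa_class (f - g)) = \<zero>\<^bsub>A\<^esub>"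
        using \<phi>_diff[OF fg(1,2)] cancel[OF hom(1)[OF fg(2)]] fg(3) by simp
      then have "f - g \<in> ?I"
        using nonzero fg(1,2)
        by (intro kernel_is_rel_ideal[OF assms(2,3) \<phi>]) (auto simp: LLPA_p_def free_algebra_closed)
      then show "llpa_class f = llpa_class g" using fg(1,2) by (simp add: ideal_class_eq_iff)
    qed
  qed
qed

end
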